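(* Let $S$ be a (possibly infinite) set of connected $d$-dimensional figures, and let $p_k(n^d)$ be the number of ways to place, on $T^d_n$ and with no two placed figures overlapping, some collection of these figures (possibly using the same figure in $S$ repeatedly) that have a total of $k$ edges. Then the $p_k(n^d)$ are eventually (for all sufficiently large $n$, for each $k$) polynomials in $n^d$, and these polynomials form a sequence of binomial type.
   Context: $T^d_\infty$ is the infinite grid graph with vertex set $\mathbb{Z}^d$, two vertices being adjacent iff they differ by $\pm$ a standard basis vector. $T^d_n=(C_n)^d$ is the toroidal grid graph with vertex set $(\mathbb{Z}/n\mathbb{Z})^d$. A $d$-dimensional figure is a finite subset of the vertices of $T^d_\infty$, up to translation by integer vectors; it is connected if the subgraph of $T^d_\infty$ it induces is connected, and its edges are the edges of this induced subgraph. For $n$ larger than the maximum coordinate difference between two of its vertices, a figure can be placed on $T^d_n$; a placement is the image in $(\mathbb{Z}/n\mathbb{Z})^d$ of a subset of $\mathbb{Z}^d$ representing it. Two placed figures overlap if they share a vertex. Repeated copies of the same figure are indistinguishable. The total number of edges of a collection is the sum, with multiplicity, of the numbers of edges of its figures. A sequence of polynomials $P_0,P_1,P_2,\dots$ is of binomial type if $P_0=1$, $P_i(0)=0$ for $i>0$, and $\left(\sum_{i\ge0}P_i(1)x^i\right)^m=\sum_{i\ge0}P_i(m)x^i$ for all nonnegative $m$; the third condition may equivalently be replaced by $P_k(x+y)=\sum_{i=0}^kP_i(x)P_{k-i}(y)$ for all $k\ge0$ (no binomial coefficients in this convention).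
   Formalization: Every figure in S is additionally assumed to have at least one edge; if S contains the single-vertex figure, then p_0(n^d) = 2^(n^d) is not a polynomial in n^d, so the claim as printed fails. *)

theory Defs
  imports "HOL-Analysis.Finite_Cartesian_Product"
    "HOL-Computational_Algebra.Polynomial"
    "HOL-Computational_Algebra.Formal_Power_Series"
begin

section \<open>The infinite grid graph on \<open>\<int>\<^sup>d\<close> and its finite induced subgraphs\<close>

text \<open>The dimension \<open>d\<close> is \<open>CARD('d)\<close>.\<close>

definition grid_adj :: "int ^ 'd \<Rightarrow> int ^ 'd \<Rightarrow> bool" where
  "grid_adj u v \<longleftrightarrow> (\<exists>i. v = u + axis i 1 \<or> v = u - axis i 1)"

definition induced_edges :: "(int ^ 'd) set \<Rightarrow> (int ^ 'd) set set" where
  "induced_edges A = {{u, v} | u v. u \<in> A \<and> v \<in> A \<and> grid_adj u v}"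

definition induced_connected :: "(int ^ 'd) set \<Rightarrow> bool" where
  "induced_connected A \<longleftrightarrow> A \<noteq> {} \<and>
     (\<forall>u\<in>A. \<forall>v\<in>A. (u, v) \<in> {(x, y). x \<in> A \<and> y \<in> A \<and> grid_adj x y}\<^sup>*)"

section \<open>Figures: finite vertex sets up to translation\<close>

definition translation_rel :: "((int ^ 'd) set \<times> (int ^ 'd) set) set" where
  "translation_rel = {(A, B). finite A \<and> finite B \<and> (\<exists>t. B = (+) t ` A)}"

type_synonym 'd figure = "(int, 'd) vec set set"

definition figures :: "('d::finite) figure set" where
  "figures = {A. finite A} // translation_rel"

definition connected_figure :: "('d::finite) figure \<Rightarrow> bool" where
  "connected_figure F \<longleftrightarrow> (\<forall>A\<in>F. induced_connected A)"

text \<open>The edge number is the same for all representatives, see \<open>figure_edges_eq\<close> below.\<close>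

definition figure_edges :: "('d::finite) figure \<Rightarrow> nat" where
  "figure_edges F = the_elem ((\<lambda>A. card (induced_edges A)) ` F)"

section \<open>Placements on the torus\<close>

text \<open>Vertices of the torus, i.e. elements of \<open>(\<int>/n\<int>)\<^sup>d\<close>, are represented by the integer vectors
  with all coordinates in \<open>{0..<n}\<close>.\<close>

definition torus_proj :: "nat \<Rightarrow> int ^ 'd \<Rightarrow> int ^ 'd" where
  "torus_proj n v = (\<chi> i. (v $ i) mod int n)"

text \<open>The side condition says that \<open>n\<close> exceeds the maximum coordinate difference between two
  vertices; a figure for which it fails has no placement.\<close>

definition placements :: "nat \<Rightarrow> ('d::finite) figure \<Rightarrow> (int ^ 'd) set set" where
  "placements n F = {torus_proj n ` A | A.
     A \<in> F \<and> (\<forall>u\<in>A. \<forall>v\<in>A. \<forall>i. \<bar>u $ i - v $ i\<bar> < int n)}"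

text \<open>A placed collection is a set of pairs (figure, placement of it). Since overlapping placements are
  forbidden, a pair with nonempty placement cannot be repeated, so a set suffices to describe a
  collection with indistinguishable repeated copies of the same figure.\<close>

definition placed_collections ::
    "('d::finite) figure set \<Rightarrow> nat \<Rightarrow> nat \<Rightarrow> ('d figure \<times> (int ^ 'd) set) set set" where
  "placed_collections S k n = {W. finite W
     \<and> (\<forall>(F, X)\<in>W. F \<in> S \<and> X \<in> placements n F)
     \<and> pairwise (\<lambda>p q. disjnt (snd p) (snd q)) W
     \<and> (\<Sum>(F, X)\<in>W. figure_edges F) = k}"

definition num_placed :: "('d::finite) figure set \<Rightarrow> nat \<Rightarrow> nat \<Rightarrow> nat" where
  "num_placed S k n = card (placed_collections S k n)"

section \<open>Polynomial sequences of binomial type\<close>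

text \<open>The convention without binomial coefficients: \<open>P\<^sub>k(x + y) = \<Sum>i\<le>k. P\<^sub>i(x) P\<^sub>k\<^sub>-\<^sub>i(y)\<close>.\<close>

definition binomial_type :: "(nat \<Rightarrow> 'a::field_char_0 poly) \<Rightarrow> bool" where
  "binomial_type P \<longleftrightarrow> P 0 = 1 \<and> (\<forall>i>0. poly (P i) 0 = 0) \<and>
     (\<forall>m::nat. Abs_fps (\<lambda>i. poly (P i) 1) ^ m = Abs_fps (\<lambda>i. poly (P i) (of_nat m)))"

section \<open>Well-definedness on translation classes\<close>

lemma equiv_translation_rel: "equiv {A. finite A} translation_rel"
proof (rule equivI)
  show "translation_rel \<subseteq> {A. finite A} \<times> {A. finite A}"
    by (auto simp: translation_rel_def)
  show "refl_on {A. finite A} translation_rel"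
    by (auto simp: refl_on_def translation_rel_def intro!: exI[of _ 0])
  show "sym translation_rel"
  proof (rule symI)
    fix A B :: "(int ^ 'd) set" assume "(A, B) \<in> translation_rel"
    then obtain t where t: "finite A" "finite B" "B = (+) t ` A"
      by (auto simp: translation_rel_def)
    then have "A = (+) (- t) ` B" by (simp add: image_image)
    with t show "(B, A) \<in> translation_rel"
      unfolding translation_rel_def by blast
  qed
  show "trans translation_rel"
  proof (rule transI)
    fix A B C :: "(int ^ 'd) set"
    assume "(A, B) \<in> translation_rel" "(B, C) \<in> translation_rel"
    then obtain s t where st: "finite A" "finite C" "B = (+) s ` A" "C = (+) t ` B"
      by (auto simp: translation_rel_def)
    then have "C = (+) (t + s) ` A" by (simp add: image_image add.assoc)
    with st show "(A, C) \<in> translation_rel"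
      unfolding translation_rel_def by blast
  qed
qed

lemma grid_adj_translate [simp]: "grid_adj (t + u) (t + v) \<longleftrightarrow> grid_adj u v"
proof -
  have "(t + v = t + u + w) = (v = u + w)" "(t + v = t + u - w) = (v = u - w)" for w
    by (metis add.assoc add_left_cancel, metis add_diff_eq add_left_cancel)
  then show ?thesis by (simp add: grid_adj_def)
qed

lemma induced_edges_translate: "induced_edges ((+) t ` A) = (`) ((+) t) ` induced_edges A"
proof (intro set_eqI iffI)
  fix e assume "e \<in> induced_edges ((+) t ` A)"
  then obtain u v where uv: "u \<in> A" "v \<in> A" "grid_adj (t + u) (t + v)" "e = {t + u, t + v}"
    unfolding induced_edges_def mem_Collect_eq by (elim exE conjE imageE) simp
  then have "{u, v} \<in> induced_edges A"
    unfolding induced_edges_def mem_Collect_eq by (intro exI[of _ u] exI[of _ v]) simp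
  with uv(4) show "e \<in> (`) ((+) t) ` induced_edges A"
    by (intro image_eqI[of _ _ "{u, v}"]) simp_all
next
  fix e assume "e \<in> (`) ((+) t) ` induced_edges A"
  then obtain u v where "u \<in> A" "v \<in> A" "grid_adj u v" "e = {t + u, t + v}"
    unfolding induced_edges_def mem_Collect_eq by (elim imageE CollectE exE conjE) simp
  then show "e \<in> induced_edges ((+) t ` A)"
    unfolding induced_edges_def mem_Collect_eq
    by (intro exI[of _ "t + u"] exI[of _ "t + v"]) simp
qed

lemma card_induced_edges_translate:
  "card (induced_edges ((+) t ` A)) = card (induced_edges A)"
proof -
  have "inj_on ((`) ((+) t)) (induced_edges A)"
  proof (rule inj_onI)
    fix x y assume "(+) t ` x = (+) t ` y"
    then show "x = y" by (metis inj_image_eq_iff inj_on_add)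
  qed
  then show ?thesis by (subst induced_edges_translate) (rule card_image)
qed

lemma figure_edges_eq:
  assumes "F \<in> figures" "A \<in> F"
  shows "figure_edges F = card (induced_edges A)"
proof -
  have "card (induced_edges B) = card (induced_edges A)" if "B \<in> F" for B
  proof -
    have "(A, B) \<in> translation_rel"
      using quotient_eq_iff[OF equiv_translation_rel, of F F A B] assms that
      unfolding figures_def by simp
    then show ?thesis
      by (auto simp: translation_rel_def card_induced_edges_translate)
  qed
  then have "(\<lambda>A. card (induced_edges A)) ` F = {card (induced_edges A)}"
    using assms(2) by blast
  then show ?thesis by (simp only: figure_edges_def the_elem_eq)
qed

end

theory Submission
  imports Defs
begin

text \<open>
  Write \<open>Z\<^sub>n = \<Sum>\<^sub>k p\<^sub>k(n\<^sup>d) x\<^sup>k\<close> for the generating function of the placed collections on the torus.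
  A sequence \<open>P\<close> is of binomial type when \<open>\<Sum>\<^sub>k P\<^sub>k(y) x\<^sup>k\<close> is the \<open>y\<close>-th power of one fixed power
  series, i.e. when its logarithmic derivative in \<open>x\<close> is \<open>y\<close> times a fixed series \<open>c\<close>. So the theorem
  says that each coefficient of \<open>Z\<^sub>n' / Z\<^sub>n\<close> is, for large \<open>n\<close>, the number \<open>n\<^sup>d\<close> of vertices times a
  constant: the free energy of a hard-core gas of figures is extensive. The coefficients of \<open>Z\<^sub>n\<close> are
  then recovered from \<open>c\<close> by the recursion that expresses \<open>Z' = y c Z\<close> (\<open>binomial_seq\<close>).

  To prove extensivity, consider the generating function \<open>Z(B)\<close> of the collections that lie inside a
  vertex set \<open>B\<close>, and write the \<open>k\<close>-th coefficient of \<open>Z(B)' / Z(B)\<close> as \<open>\<Sum>\<^bsub>A \<subseteq> B\<^esub> \<phi>(A)\<close>, with the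
  cluster weight \<open>\<phi>\<close> given by Moebius inversion over subsets. Two facts localise \<open>\<phi>\<close>.

  \<^item> \<open>\<phi>(A) = 0\<close> if \<open>A\<close> falls into two nonempty parts that no figure connects: then \<open>Z\<close> is a product
    over the two parts, its logarithmic derivative is a sum of two functions, each blind to one of
    the parts, and Moebius inversion kills such functions (\<open>cluster_weight_eq_0_if_separated\<close>).
  \<^item> \<open>\<phi>(A) = 0\<close> if \<open>A\<close> has more than \<open>2(k+1)\<close> elements. Call a set function of degree at most \<open>m\<close> if
    its Moebius transform vanishes on larger sets. Degrees add under products. The \<open>j\<close>-th
    coefficient of \<open>Z\<close> has degree at most \<open>2j\<close>, because \<open>j\<close> edges cover at most \<open>2j\<close> vertices, and the
    recursion for \<open>Z' / Z\<close> preserves this grading (\<open>interaction_le_log_deriv\<close>).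

  Hence only sets \<open>A\<close> of bounded diameter contribute. Distribute the weight of each \<open>A\<close> evenly over its
  elements; since the torus is vertex-transitive, every vertex receives the same amount, which is
  the sum of \<open>\<phi>(A) / |A|\<close> over the \<open>A\<close> that contain the origin. For large \<open>n\<close> such \<open>A\<close> do not wrap around
  the torus, so \<open>\<phi>(A)\<close> may be computed on \<open>\<int>\<^sup>d\<close> and the sum does not depend on \<open>n\<close>
  (\<open>cluster_weight_torus_proj\<close>, \<open>log_deriv_torus\<close>).
\<close>

section \<open>Set functions and Moebius inversion\<close>

text \<open>The sign is \<open>(-1)\<^bsup>|A| + |B|\<^esup>\<close> instead of \<open>(-1)\<^bsup>|A - B|\<^esup>\<close>, which is the same for finite sets and
  separates into two factors.\<close>

definition mobius :: "('v set \<Rightarrow> real) \<Rightarrow> 'v set \<Rightarrow> real" where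
  "mobius f A = (\<Sum>B\<in>Pow A. (-1) ^ (card A + card B) * f B)"

lemma mobius_cong: "(\<And>B. B \<subseteq> A \<Longrightarrow> f B = g B) \<Longrightarrow> mobius f A = mobius g A"
  unfolding mobius_def by (intro sum.cong) auto

lemma sum_mobius:
  assumes "finite A"
  shows "(\<Sum>B\<in>Pow A. mobius f B) = f A"
proof -
  have "f A = (\<Sum>T\<in>Pow A. (-1) ^ card T * (\<Sum>U\<in>Pow T. (-1) ^ card U * f U))"
    by (rule inclusion_exclusion_symmetric) (auto simp: assms)
  also have "\<dots> = (\<Sum>T\<in>Pow A. mobius f T)"
    by (simp add: mobius_def sum_distrib_left power_add mult.assoc)
  finally show ?thesis by simp
qed

lemma mobius_unique:
  assumes "\<And>B. finite B \<Longrightarrow> f B = (\<Sum>A\<in>Pow B. \<psi> A)" and "finite A"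
  shows "mobius f A = \<psi> A"
proof -
  have "\<psi> A = (\<Sum>T \<in> Pow A. (-1) ^ (card A - card T) * f T)"
    by (rule inclusion_exclusion_mobius[OF assms])
  also have "\<dots> = mobius f A"
    unfolding mobius_def using assms(2)
    by (intro sum.cong) (auto simp: card_mono neg_one_power_add_eq_neg_one_power_diff)
  finally show ?thesis by simp
qed

lemma mobius_add: "mobius (\<lambda>B. f B + g B) A = mobius f A + mobius g A"
  by (simp add: mobius_def algebra_simps sum.distrib)

lemma mobius_scale: "mobius (\<lambda>B. c * f B) A = c * mobius f A"
  by (simp add: mobius_def algebra_simps sum_distrib_left)

text \<open>Toggling the membership of \<open>x\<close> pairs the subsets of \<open>A\<close> with opposite signs.\<close>

lemma mobius_eq_0_if_insensitive:
  assumes "finite A" "x \<in> A" and g: "\<And>B. B \<subseteq> A - {x} \<Longrightarrow> g (insert x B) = g B"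
  shows "mobius g A = 0"
proof -
  define A' where "A' = A - {x}"
  have A: "A = insert x A'" "x \<notin> A'" "finite A'" using assms by (auto simp: A'_def)
  have inj: "inj_on (insert x) (Pow A')" using A(2) by (auto simp: inj_on_def)
  have "mobius g A = (\<Sum>B\<in>Pow A' \<union> insert x ` Pow A'. (-1) ^ (card A + card B) * g B)"
    unfolding mobius_def by (simp add: A(1) Pow_insert)
  also have "\<dots> = (\<Sum>B\<in>Pow A'. (-1) ^ (card A + card B) * g B)
      + (\<Sum>B\<in>insert x ` Pow A'. (-1) ^ (card A + card B) * g B)"
    using A by (intro sum.union_disjoint) auto
  also have "(\<Sum>B\<in>insert x ` Pow A'. (-1) ^ (card A + card B) * g B)
      = (\<Sum>B\<in>Pow A'. (-1) ^ (card A + card (insert x B)) * g (insert x B))"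
    by (simp add: sum.reindex[OF inj])
  also have "\<dots> = (\<Sum>B\<in>Pow A'. - ((-1) ^ (card A + card B) * g B))"
  proof (rule sum.cong[OF refl])
    fix B assume "B \<in> Pow A'"
    then have "x \<notin> B" "finite B"
      using A(2,3) by (auto intro: finite_subset)
    moreover have "g (insert x B) = g B"
      using \<open>B \<in> Pow A'\<close> g by (simp add: A'_def)
    ultimately show "(-1) ^ (card A + card (insert x B)) * g (insert x B) = - ((-1) ^ (card A + card B) * g B)"
      by simp
  qed
  finally show ?thesis by (simp add: sum_negf)
qed

text \<open>Each of the two summands ignores the elements of the other part, which is nonempty.\<close>

lemma mobius_eq_0_if_additive:
  assumes "finite A" "A1 \<inter> A2 = {}" "A1 \<union> A2 = A" "A1 \<noteq> {}" "A2 \<noteq> {}"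
    and f: "\<And>B. B \<subseteq> A \<Longrightarrow> f B = f (B \<inter> A1) + f (B \<inter> A2)"
  shows "mobius f A = 0"
proof -
  obtain x y where xy: "x \<in> A2" "y \<in> A1" using assms by blast
  have "mobius f A = mobius (\<lambda>B. f (B \<inter> A1)) A + mobius (\<lambda>B. f (B \<inter> A2)) A"
    unfolding mobius_add[symmetric] by (rule mobius_cong[OF f])
  moreover have "mobius (\<lambda>B. f (B \<inter> A1)) A = 0"
    by (rule mobius_eq_0_if_insensitive[of _ x])
      (use assms xy in \<open>auto intro!: arg_cong[of _ _ f]\<close>)
  moreover have "mobius (\<lambda>B. f (B \<inter> A2)) A = 0"
    by (rule mobius_eq_0_if_insensitive[of _ y])
      (use assms xy in \<open>auto intro!: arg_cong[of _ _ f]\<close>)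
  ultimately show ?thesis by simp
qed

text \<open>These are the set functions that are sums of terms each depending on at most \<open>m\<close> points, like
  polynomials of degree at most \<open>m\<close> in the indicator variables of the points.\<close>

definition interaction_le :: "nat \<Rightarrow> ('v set \<Rightarrow> real) \<Rightarrow> bool" where
  "interaction_le m f \<longleftrightarrow> (\<forall>A. finite A \<longrightarrow> m < card A \<longrightarrow> mobius f A = 0)"

lemma interaction_leI:
  assumes "\<And>B. finite B \<Longrightarrow> f B = (\<Sum>A\<in>Pow B. \<psi> A)"
    and "\<And>A. finite A \<Longrightarrow> m < card A \<Longrightarrow> \<psi> A = 0"
  shows "interaction_le m f"
  unfolding interaction_le_def using mobius_unique[of f \<psi>] assms by simp

lemma interaction_le_mono: "interaction_le m f \<Longrightarrow> m \<le> m' \<Longrightarrow> interaction_le m' f"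
  by (auto simp: interaction_le_def)

lemma interaction_le_add:
  "interaction_le m f \<Longrightarrow> interaction_le m g \<Longrightarrow> interaction_le m (\<lambda>B. f B + g B)"
  by (simp add: interaction_le_def mobius_add)

lemma interaction_le_scale: "interaction_le m f \<Longrightarrow> interaction_le m (\<lambda>B. c * f B)"
  by (simp add: interaction_le_def mobius_scale)

lemma interaction_le_sum:
  assumes "finite J" "\<And>j. j \<in> J \<Longrightarrow> interaction_le m (f j)"
  shows "interaction_le m (\<lambda>B. \<Sum>j\<in>J. f j B)"
  using assms
proof (induction J rule: finite_induct)
  case empty
  show ?case by (simp add: interaction_le_def mobius_def)
next
  case (insert j J)
  then show ?case by (simp add: interaction_le_add)
qed

text \<open>Expanding both factors, the pair \<open>(A1, A2)\<close> contributes to the interaction on \<open>A1 \<union> A2\<close>, which has at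
  most \<open>m + m'\<close> elements when both of its terms are nonzero.\<close>

lemma interaction_le_mult:
  assumes f: "interaction_le m f" and g: "interaction_le m' g"
  shows "interaction_le (m + m') (\<lambda>B. f B * g B)"
proof -
  \<comment> \<open>the Moebius transform of the product, grouped by the union of the two index sets\<close>
  define \<psi> where "\<psi> = (\<lambda>A. \<Sum>(A1, A2) \<in> {P \<in> Pow A \<times> Pow A. fst P \<union> snd P = A}.
     mobius f A1 * mobius g A2)"
  show ?thesis
  proof (rule interaction_leI)
    fix B :: "'a set" assume B: "finite B"
    have "f B * g B = (\<Sum>P\<in>Pow B \<times> Pow B. mobius f (fst P) * mobius g (snd P))"
      unfolding sum_mobius[OF B, of f, symmetric] sum_mobius[OF B, of g, symmetric]
      by (simp add: sum_product sum.cartesian_product case_prod_unfold)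
    also have "\<dots> = (\<Sum>A\<in>Pow B. \<Sum>P | P \<in> Pow B \<times> Pow B \<and> fst P \<union> snd P = A.
        mobius f (fst P) * mobius g (snd P))"
      using B by (intro sum.group[symmetric]) auto
    also have "\<dots> = (\<Sum>A\<in>Pow B. \<psi> A)"
      unfolding \<psi>_def case_prod_unfold by (intro sum.cong refl) auto
    finally show "f B * g B = (\<Sum>A\<in>Pow B. \<psi> A)" .
  next
    fix A :: "'a set" assume A: "finite A" "m + m' < card A"
    have "mobius f A1 * mobius g A2 = 0" if "A1 \<subseteq> A" "A2 \<subseteq> A" "A1 \<union> A2 = A" for A1 A2
    proof -
      have "finite A1" "finite A2" using that A by (auto intro: finite_subset)
      moreover have "m < card A1 \<or> m' < card A2"
        using A(2) card_Un_le[of A1 A2] unfolding that(3) by linarith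
      ultimately show ?thesis using f g by (auto simp: interaction_le_def)
    qed
    then show "\<psi> A = 0" unfolding \<psi>_def by (intro sum.neutral) auto
  qed
qed

section \<open>Logarithmic derivatives of power series\<close>

unbundle no vec_syntax
unbundle fps_syntax

definition log_deriv :: "real fps \<Rightarrow> real fps" where
  "log_deriv f = fps_deriv f * inverse f"

lemma log_deriv_mult_self: "f $ 0 = 1 \<Longrightarrow> log_deriv f * f = fps_deriv f"
  by (simp add: log_deriv_def mult.assoc inverse_mult_eq_1)

text \<open>Comparing coefficients in \<open>(f' / f) f = f'\<close> determines the coefficients of \<open>f' / f\<close> recursively. The
  difference is written as a sum with factor \<open>-1\<close> so that closure under sums and scalar multiples
  applies to it directly.\<close>

lemma log_deriv_nth:
  assumes "f $ 0 = 1"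
  shows "log_deriv f $ k = real (Suc k) * f $ Suc k + (-1) * (\<Sum>j<k. log_deriv f $ j * f $ (k - j))"
proof -
  have "real (Suc k) * f $ Suc k = (log_deriv f * f) $ k"
    by (simp add: log_deriv_mult_self[OF assms])
  also have "\<dots> = (\<Sum>j<k. log_deriv f $ j * f $ (k - j)) + log_deriv f $ k"
    by (simp add: fps_mult_nth assms atLeast0AtMost flip: lessThan_Suc_atMost)
  finally show ?thesis by simp
qed

lemma log_deriv_cong:
  assumes "f $ 0 = 1" and "\<And>i. i \<le> Suc k \<Longrightarrow> f $ i = g $ i"
  shows "log_deriv f $ k = log_deriv g $ k"
  using assms(2)
proof (induction k rule: less_induct)
  case (less k)
  have "g $ 0 = 1" using assms(1) less.prems[of 0] by simp
  moreover have "(\<Sum>j<k. log_deriv f $ j * f $ (k - j)) = (\<Sum>j<k. log_deriv g $ j * g $ (k - j))"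
    using less by (intro sum.cong) auto
  ultimately show ?case
    using log_deriv_nth[OF assms(1), of k] log_deriv_nth[of g k] less.prems[of "Suc k"] by simp
qed

lemma log_deriv_mult:
  assumes "f $ 0 = 1" "g $ 0 = 1"
  shows "log_deriv (f * g) = log_deriv f + log_deriv g"
proof -
  have "log_deriv (f * g) * (f * g) = (log_deriv f + log_deriv g) * (f * g)"
    using assms log_deriv_mult_self[of f] log_deriv_mult_self[of g] log_deriv_mult_self[of "f * g"]
    by (simp add: algebra_simps)
  moreover have "f * g \<noteq> 0" using assms by (metis fps_mult_nth_0 fps_zero_nth mult_1 zero_neq_one)
  ultimately show ?thesis by simp
qed

lemma log_deriv_eq_imp_nth_eq:
  assumes "f $ 0 = 1" "g $ 0 = 1" and "\<And>j. j < k \<Longrightarrow> log_deriv f $ j = log_deriv g $ j"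
  shows "f $ k = g $ k"
  using assms(3)
proof (induction k rule: less_induct)
  case (less k)
  show ?case
  proof (cases k)
    case 0
    then show ?thesis using assms by simp
  next
    case (Suc l)
    have "log_deriv f $ l = log_deriv g $ l" using less.prems Suc by simp
    moreover have "(\<Sum>j<l. log_deriv f $ j * f $ (l - j)) = (\<Sum>j<l. log_deriv g $ j * g $ (l - j))"
      using less Suc by (intro sum.cong) auto
    ultimately have "real (Suc l) * f $ Suc l = real (Suc l) * g $ Suc l"
      using log_deriv_nth[OF assms(1), of l] log_deriv_nth[OF assms(2), of l] by simp
    then show ?thesis using Suc by simp
  qed
qed

section \<open>The binomial sequence with given logarithmic derivative\<close>

text \<open>The coefficients of \<open>exp (y \<Sum>\<^sub>k c\<^sub>k x\<^sup>k\<^sup>+\<^sup>1 / (k + 1))\<close> as polynomials in \<open>y\<close>, by the recursion that its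
  differential equation \<open>F' = y c F\<close> imposes.\<close>

fun binomial_seq :: "(nat \<Rightarrow> real) \<Rightarrow> nat \<Rightarrow> real poly" where
  "binomial_seq c 0 = 1"
| "binomial_seq c (Suc k) =
     smult (1 / real (Suc k)) (\<Sum>j\<le>k. [:0, c j:] * binomial_seq c (k - j))"

lemma log_deriv_binomial_seq:
  "log_deriv (Abs_fps (\<lambda>k. poly (binomial_seq c k) y)) = fps_const y * Abs_fps c" (is "log_deriv ?F = _")
proof -
  have F: "?F $ 0 = 1" by simp
  have "fps_deriv ?F = fps_const y * Abs_fps c * ?F"
  proof (rule fps_ext)
    fix k
    have "fps_deriv ?F $ k = (\<Sum>j\<le>k. y * c j * poly (binomial_seq c (k - j)) y)"
      by (simp add: poly_sum mult.assoc del: of_nat_Suc)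
    also have "\<dots> = (fps_const y * Abs_fps c * ?F) $ k"
      by (simp add: fps_mult_nth[of "fps_const y * Abs_fps c"] atLeast0AtMost)
    finally show "fps_deriv ?F $ k = (fps_const y * Abs_fps c * ?F) $ k" .
  qed
  then show ?thesis using inverse_mult_eq_1[of ?F] F
    by (simp add: log_deriv_def mult.assoc mult.commute[of ?F])
qed

text \<open>Logarithmic derivatives turn products into sums, so \<open>F\<^sub>x F\<^sub>y\<close> and \<open>F\<^bsub>x + y\<^esub>\<close> have the same one and hence
  coincide; the power law is the iterate of this.\<close>

lemma binomial_type_binomial_seq: "binomial_type (binomial_seq c)"
  unfolding binomial_type_def
proof (intro conjI allI impI)
  let ?F = "\<lambda>y. Abs_fps (\<lambda>k. poly (binomial_seq c k) y)"
  have mult: "?F x * ?F y = ?F (x + y)" for x y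
  proof (rule fps_ext)
    fix k
    have "log_deriv (?F x * ?F y) = log_deriv (?F (x + y))"
      unfolding log_deriv_binomial_seq by (subst log_deriv_mult)
        (simp_all add: log_deriv_binomial_seq distrib_right flip: fps_const_add)
    then show "(?F x * ?F y) $ k = ?F (x + y) $ k"
      by (intro log_deriv_eq_imp_nth_eq[of "?F x * ?F y" "?F (x + y)"]) simp_all
  qed
  have zero: "poly (binomial_seq c i) 0 = 0" if "i > 0" for i
    using that by (cases i) (simp_all add: poly_sum)
  show "binomial_seq c 0 = 1" by simp
  show "poly (binomial_seq c i) 0 = 0" if "0 < i" for i using zero that .
  fix m
  show "?F 1 ^ m = ?F (of_nat m)"
  proof (induction m)
    case 0
    have "?F 0 $ k = 1 $ k" for k using zero[of k] by (cases k) auto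
    then show ?case by (simp add: fps_eq_iff del: fps_nth_Abs_fps)
  next
    case (Suc m)
    then show ?case by (simp add: mult add.commute)
  qed
qed

section \<open>Hard-core collections of polymers\<close>

text \<open>A polymer is a pair of a label, which carries the weight, and a support. The label matters since
  different figures may have the same image on a small torus.\<close>

definition collections ::
    "('f \<times> 'v set) set \<Rightarrow> ('f \<Rightarrow> nat) \<Rightarrow> 'v set \<Rightarrow> nat \<Rightarrow> ('f \<times> 'v set) set set" where
  "collections \<Gamma> w B k = {W. finite W \<and> W \<subseteq> \<Gamma> \<and> (\<forall>p\<in>W. snd p \<subseteq> B)
     \<and> pairwise (\<lambda>p q. disjnt (snd p) (snd q)) W \<and> (\<Sum>p\<in>W. w (fst p)) = k}"

text \<open>The grand-canonical partition function of the hard-core polymer gas confined to \<open>B\<close>.\<close>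

definition partition_fps :: "('f \<times> 'v set) set \<Rightarrow> ('f \<Rightarrow> nat) \<Rightarrow> 'v set \<Rightarrow> real fps" where
  "partition_fps \<Gamma> w B = Abs_fps (\<lambda>k. real (card (collections \<Gamma> w B k)))"

text \<open>This is \<open>k + 1\<close> times the coefficient of \<open>x\<^sup>k\<^sup>+\<^sup>1\<close> in the contribution of the clusters with union exactly \<open>A\<close>
  to the Mayer expansion of the logarithm of the partition function.\<close>

definition cluster_weight :: "('f \<times> 'v set) set \<Rightarrow> ('f \<Rightarrow> nat) \<Rightarrow> nat \<Rightarrow> 'v set \<Rightarrow> real" where
  "cluster_weight \<Gamma> w k = mobius (\<lambda>B. log_deriv (partition_fps \<Gamma> w B) $ k)"

lemma weight_le_if_collection:
  assumes "W \<in> collections \<Gamma> w B k" "p \<in> W"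
  shows "w (fst p) \<le> k"
proof -
  have "w (fst p) \<le> (\<Sum>p\<in>W. w (fst p))"
    using assms by (intro member_le_sum) (auto simp: collections_def)
  then show ?thesis using assms by (auto simp: collections_def)
qed

text \<open>Collections of total weight \<open>k\<close> contain only polymers of weight at most \<open>k\<close>, so \<open>g\<close> has to match the
  polymers only up to that weight. This is what allows a comparison of the torus, for a fixed size,
  with the infinite grid.\<close>

lemma card_collections_transport:
  assumes inj: "inj_on g B"
    and \<Gamma>': "{p \<in> \<Gamma>'. snd p \<subseteq> g ` B \<and> w (fst p) \<le> k}
          = apsnd ((`) g) ` {p \<in> \<Gamma>. snd p \<subseteq> B \<and> w (fst p) \<le> k}"
  shows "card (collections \<Gamma>' w (g ` B) k) = card (collections \<Gamma> w B k)"
proof -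
  let ?g = "apsnd ((`) g) :: 'c \<times> 'a set \<Rightarrow> 'c \<times> 'b set"
  let ?U = "{p \<in> \<Gamma>. snd p \<subseteq> B \<and> w (fst p) \<le> k}"
  have inj': "inj_on ?g ?U"
    using inj_on_image_Pow[OF inj] by (auto simp: inj_on_def)
  have disj: "disjnt (g ` X) (g ` Y) \<longleftrightarrow> disjnt X Y" if "X \<subseteq> B" "Y \<subseteq> B" for X Y
    using that inj by (simp add: disjnt_def inj_on_image_Int[symmetric])
  have coll: "?g ` W \<in> collections \<Gamma>' w (g ` B) k \<longleftrightarrow> W \<in> collections \<Gamma> w B k" if W: "W \<subseteq> ?U" for W
  proof -
    have injW: "inj_on ?g W" using inj' W by (rule inj_on_subset)
    have "?g ` W \<subseteq> {p \<in> \<Gamma>'. snd p \<subseteq> g ` B \<and> w (fst p) \<le> k}"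
      unfolding \<Gamma>' using W by blast
    then have "?g ` W \<subseteq> \<Gamma>'" "\<forall>p\<in>?g ` W. snd p \<subseteq> g ` B" by blast+
    moreover have "W \<subseteq> \<Gamma>" "\<forall>p\<in>W. snd p \<subseteq> B" using W by blast+
    moreover have "finite (?g ` W) \<longleftrightarrow> finite W" using injW by (rule finite_image_iff)
    moreover have "(\<Sum>p\<in>?g ` W. w (fst p)) = (\<Sum>p\<in>W. w (fst p))"
      by (simp add: sum.reindex[OF injW])
    moreover have "pairwise (\<lambda>p q. disjnt (snd p) (snd q)) (?g ` W)
        \<longleftrightarrow> pairwise (\<lambda>p q. disjnt (snd p) (snd q)) W"
    proof -
      have "disjnt (snd (?g p)) (snd (?g q)) \<longleftrightarrow> disjnt (snd p) (snd q)" if "p \<in> W" "q \<in> W" for p q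
        using disj[of "snd p" "snd q"] that W by auto
      moreover have "?g p = ?g q \<longleftrightarrow> p = q" if "p \<in> W" "q \<in> W" for p q
        using injW that by (simp add: inj_on_eq_iff)
      ultimately show ?thesis unfolding pairwise_def by simp
    qed
    ultimately show ?thesis unfolding collections_def mem_Collect_eq by argo
  qed
  have "bij_betw ((`) ?g) (collections \<Gamma> w B k) (collections \<Gamma>' w (g ` B) k)"
  proof (rule bij_betw_imageI)
    have U: "W \<subseteq> ?U" if "W \<in> collections \<Gamma> w B k" for W
      using that weight_le_if_collection[OF that] by (auto simp: collections_def)
    show "inj_on ((`) ?g) (collections \<Gamma> w B k)"
      by (intro inj_on_subset[OF inj_on_image_Pow[OF inj']] subsetI, rule PowI, rule U)
    have "W' \<in> (`) ?g ` collections \<Gamma> w B k" if W': "W' \<in> collections \<Gamma>' w (g ` B) k" for W'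
    proof -
      have "W' \<subseteq> {p \<in> \<Gamma>'. snd p \<subseteq> g ` B \<and> w (fst p) \<le> k}"
        using W' weight_le_if_collection[OF W'] by (auto simp: collections_def)
      then obtain W where "W \<subseteq> ?U" "W' = ?g ` W" unfolding \<Gamma>' by (meson subset_imageE)
      then show ?thesis using coll[of W] W' by (intro image_eqI[of _ _ W]) simp_all
    qed
    moreover have "?g ` W \<in> collections \<Gamma>' w (g ` B) k" if "W \<in> collections \<Gamma> w B k" for W
      using coll[OF U[OF that]] that by (rule iffD2)
    ultimately show "(`) ?g ` collections \<Gamma> w B k = collections \<Gamma>' w (g ` B) k"
      by (intro equalityI subsetI) auto
  qed
  then show ?thesis by (metis bij_betw_same_card)
qed

text \<open>The bound on the size of a support holds for figures because every vertex of a connected figure with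
  an edge is an endpoint of one of its edges. It also forces positive weights, so that
  only the empty collection has weight \<open>0\<close>.\<close>

locale polymer_system =
  fixes \<Gamma> :: "('f \<times> 'v set) set" and w :: "'f \<Rightarrow> nat"
  assumes finite_inside: "finite B \<Longrightarrow> finite {p \<in> \<Gamma>. snd p \<subseteq> B}"
    and finite_polymer: "p \<in> \<Gamma> \<Longrightarrow> finite (snd p)"
    and nonempty_polymer: "p \<in> \<Gamma> \<Longrightarrow> snd p \<noteq> {}"
    and card_polymer_le: "p \<in> \<Gamma> \<Longrightarrow> card (snd p) \<le> 2 * w (fst p)"
begin

abbreviation "coll \<equiv> collections \<Gamma> w"
abbreviation "Z \<equiv> partition_fps \<Gamma> w"
abbreviation "\<phi> \<equiv> cluster_weight \<Gamma> w"

lemma weight_pos: "p \<in> \<Gamma> \<Longrightarrow> w (fst p) > 0"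
  using finite_polymer[of p] nonempty_polymer[of p] card_polymer_le[of p]
  by (metis card_gt_0_iff gr0I leD mult_0_right)

lemma finite_coll: "finite B \<Longrightarrow> finite (coll B k)"
  by (rule finite_subset[of _ "Pow {p \<in> \<Gamma>. snd p \<subseteq> B}"])
    (auto simp: collections_def intro: finite_inside)

lemma coll_0: "coll B 0 = {{}}"
proof -
  have "W = {}" if "W \<in> coll B 0" for W
    using that weight_le_if_collection[OF that] weight_pos by (fastforce simp: collections_def)
  moreover have "{} \<in> coll B 0" by (simp add: collections_def)
  ultimately show ?thesis by blast
qed

lemma partition_fps_0 [simp]: "Z B $ 0 = 1"
  by (simp add: partition_fps_def coll_0)

lemma partition_fps_empty: "Z {} = 1"
proof (rule fps_ext)
  fix k
  have "coll {} k = (if k = 0 then {{}} else {})"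
  proof -
    have "W = {}" if "W \<in> coll {} k" for W
      using that nonempty_polymer by (fastforce simp: collections_def)
    then have "coll {} k \<subseteq> {{}}" by blast
    moreover have "{} \<in> coll {} k \<longleftrightarrow> k = 0" by (auto simp: collections_def)
    ultimately show ?thesis by (auto simp: subset_singleton_iff)
  qed
  then show "Z {} $ k = 1 $ k" by (simp add: partition_fps_def)
qed

text \<open>If no light polymer meets both parts, a collection is a pair of independent collections.\<close>

lemma card_coll_disjoint_union:
  assumes fin: "finite A1" "finite A2" and disj: "A1 \<inter> A2 = {}"
    and sep: "\<And>p. p \<in> \<Gamma> \<Longrightarrow> w (fst p) \<le> k \<Longrightarrow> snd p \<subseteq> A1 \<union> A2 \<Longrightarrow> snd p \<subseteq> A1 \<or> snd p \<subseteq> A2"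
  shows "card (coll (A1 \<union> A2) k) = (\<Sum>i=0..k. card (coll A1 i) * card (coll A2 (k - i)))"
proof -
  let ?dom = "SIGMA i:{0..k}. coll A1 i \<times> coll A2 (k - i)"
  let ?join = "\<lambda>(i :: nat, W1, W2). W1 \<union> W2"
  let ?part = "\<lambda>W A. {p \<in> W. snd p \<subseteq> A}"
  have excl: "\<not> (snd p \<subseteq> A1 \<and> snd p \<subseteq> A2)" if "p \<in> \<Gamma>" for p
    using nonempty_polymer[OF that] disj by blast
  have "bij_betw ?join ?dom (coll (A1 \<union> A2) k)"
  proof (rule bij_betw_byWitness[where f' = "\<lambda>W. (\<Sum>p\<in>?part W A1. w (fst p), ?part W A1, ?part W A2)"])
    show "\<forall>a\<in>?dom. (\<Sum>p\<in>?part (?join a) A1. w (fst p), ?part (?join a) A1, ?part (?join a) A2) = a"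
    proof
      fix a assume "a \<in> ?dom"
      then obtain i W1 W2 where a: "a = (i, W1, W2)" "W1 \<in> coll A1 i" "W2 \<in> coll A2 (k - i)" by auto
      then have "?part (W1 \<union> W2) A1 = W1" "?part (W1 \<union> W2) A2 = W2"
        using excl unfolding collections_def by blast+
      then show "(\<Sum>p\<in>?part (?join a) A1. w (fst p), ?part (?join a) A1, ?part (?join a) A2) = a"
        using a by (simp add: collections_def)
    qed
    have split: "W = ?part W A1 \<union> ?part W A2 \<and> ?part W A1 \<inter> ?part W A2 = {}
        \<and> (\<Sum>p\<in>W. w (fst p)) = (\<Sum>p\<in>?part W A1. w (fst p)) + (\<Sum>p\<in>?part W A2. w (fst p))"
      if W: "W \<in> coll (A1 \<union> A2) k" for W
    proof -
      have 1: "W = ?part W A1 \<union> ?part W A2"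
        using sep weight_le_if_collection[OF W] W unfolding collections_def by blast
      have 2: "?part W A1 \<inter> ?part W A2 = {}"
        using excl W unfolding collections_def by blast
      have "finite W" using W by (simp add: collections_def)
      then have "(\<Sum>p\<in>?part W A1 \<union> ?part W A2. w (fst p))
          = (\<Sum>p\<in>?part W A1. w (fst p)) + (\<Sum>p\<in>?part W A2. w (fst p))"
        using 2 by (intro sum.union_disjoint) auto
      with 1 2 show ?thesis by simp
    qed
    then show "\<forall>W\<in>coll (A1 \<union> A2) k.
        ?join (\<Sum>p\<in>?part W A1. w (fst p), ?part W A1, ?part W A2) = W" by fastforce
    show "?join ` ?dom \<subseteq> coll (A1 \<union> A2) k"
    proof
      fix W assume "W \<in> ?join ` ?dom"
      then obtain i W1 W2 where W: "W = W1 \<union> W2" "i \<le> k" "W1 \<in> coll A1 i" "W2 \<in> coll A2 (k - i)"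
        by auto
      have d: "disjnt (snd p) (snd q)" if "p \<in> W1" "q \<in> W2" for p q
        using W that disj unfolding collections_def disjnt_def by blast
      have "W1 \<inter> W2 = {}"
        using W excl unfolding collections_def by blast
      then have "(\<Sum>p\<in>W. w (fst p)) = k"
        using W unfolding collections_def by (simp add: sum.union_disjoint)
      moreover have "pairwise (\<lambda>p q. disjnt (snd p) (snd q)) W1"
        "pairwise (\<lambda>p q. disjnt (snd p) (snd q)) W2"
        using W by (simp_all add: collections_def)
      then have "pairwise (\<lambda>p q. disjnt (snd p) (snd q)) W"
        unfolding W(1) pairwise_def using d by (metis Un_iff disjnt_sym)
      moreover have "finite W" "W \<subseteq> \<Gamma>" "\<forall>p\<in>W. snd p \<subseteq> A1 \<union> A2"
        using W by (auto simp: collections_def)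
      ultimately show "W \<in> coll (A1 \<union> A2) k"
        by (simp add: collections_def)
    qed
    show "(\<lambda>W. (\<Sum>p\<in>?part W A1. w (fst p), ?part W A1, ?part W A2)) ` coll (A1 \<union> A2) k \<subseteq> ?dom"
    proof (rule image_subsetI)
      fix W assume W: "W \<in> coll (A1 \<union> A2) k"
      let ?i = "\<Sum>p\<in>?part W A1. w (fst p)"
      have k: "?i + (\<Sum>p\<in>?part W A2. w (fst p)) = k"
        using split[OF W] W by (simp add: collections_def)
      have pw: "pairwise (\<lambda>p q. disjnt (snd p) (snd q)) (?part W A)" for A
        using W by (auto simp: collections_def pairwise_def)
      have fin: "finite (?part W A)" for A using W by (simp add: collections_def)
      have \<Gamma>: "W \<subseteq> \<Gamma>" using W by (simp add: collections_def)
      have "?part W A1 \<in> coll A1 ?i" "?part W A2 \<in> coll A2 (k - ?i)"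
        using pw fin \<Gamma> k by (auto simp: collections_def)
      with k show "(?i, ?part W A1, ?part W A2) \<in> ?dom" by auto
    qed
  qed
  then have "card (coll (A1 \<union> A2) k) = card ?dom" by (rule bij_betw_same_card[symmetric])
  also have "\<dots> = (\<Sum>i=0..k. card (coll A1 i) * card (coll A2 (k - i)))"
    using fin finite_coll by (subst card_SigmaI) (auto simp: card_cartesian_product)
  finally show ?thesis .
qed

lemma log_deriv_partition_disjoint_union:
  assumes "finite A1" "finite A2" "A1 \<inter> A2 = {}"
    and sep: "\<And>p. p \<in> \<Gamma> \<Longrightarrow> w (fst p) \<le> Suc k \<Longrightarrow> snd p \<subseteq> A1 \<union> A2 \<Longrightarrow> snd p \<subseteq> A1 \<or> snd p \<subseteq> A2"
  shows "log_deriv (Z (A1 \<union> A2)) $ k = log_deriv (Z A1) $ k + log_deriv (Z A2) $ k"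
proof -
  have "log_deriv (Z (A1 \<union> A2)) $ k = log_deriv (Z A1 * Z A2) $ k"
  proof (rule log_deriv_cong)
    fix i assume "i \<le> Suc k"
    then have "card (coll (A1 \<union> A2) i) = (\<Sum>j=0..i. card (coll A1 j) * card (coll A2 (i - j)))"
      using sep by (intro card_coll_disjoint_union assms) auto
    then show "Z (A1 \<union> A2) $ i = (Z A1 * Z A2) $ i"
      by (simp add: partition_fps_def fps_mult_nth)
  qed simp
  then show ?thesis by (simp add: log_deriv_mult)
qed

section \<open>Locality of cluster weights\<close>

text \<open>Sort the collections by the union of their supports, which has at most \<open>2k\<close> elements.\<close>

lemma interaction_le_partition: "interaction_le (2 * k) (\<lambda>B. Z B $ k)"
proof (rule interaction_leI)
  \<comment> \<open>collections that cover \<open>A\<close>; a family that does not refer to the ambient set \<open>B\<close>\<close>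
  define exact where "exact = (\<lambda>A. {W \<in> coll A k. (\<Union>p\<in>W. snd p) = A})"
  fix B :: "'v set" assume B: "finite B"
  have "coll B k = (\<Union>A\<in>Pow B. exact A)"
  proof (intro equalityI subsetI)
    fix W assume W: "W \<in> coll B k"
    then have "(\<Union>p\<in>W. snd p) \<in> Pow B" "W \<in> exact (\<Union>p\<in>W. snd p)"
      by (auto simp: exact_def collections_def)
    then show "W \<in> (\<Union>A\<in>Pow B. exact A)" by (rule UN_I)
  next
    fix W assume "W \<in> (\<Union>A\<in>Pow B. exact A)"
    then obtain A where "A \<subseteq> B" "W \<in> coll A k" by (auto simp: exact_def)
    then show "W \<in> coll B k"
      unfolding collections_def mem_Collect_eq by (meson order_trans)
  qed
  moreover have "card (\<Union>A\<in>Pow B. exact A) = (\<Sum>A\<in>Pow B. card (exact A))"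
    using B by (intro card_UN_disjoint)
      (auto simp: exact_def intro!: finite_subset[OF _ finite_coll] dest: finite_subset)
  ultimately show "Z B $ k = (\<Sum>A\<in>Pow B. real (card {W \<in> coll A k. (\<Union>p\<in>W. snd p) = A}))"
    by (simp add: partition_fps_def exact_def)
next
  fix A :: "'v set" assume A: "finite A" "2 * k < card A"
  have "(\<Union>p\<in>W. snd p) \<noteq> A" if W: "W \<in> coll A k" for W
  proof
    assume "(\<Union>p\<in>W. snd p) = A"
    then have "card A \<le> (\<Sum>p\<in>W. card (snd p))"
      using card_UN_le[of W snd] W by (auto simp: collections_def)
    also have "\<dots> \<le> (\<Sum>p\<in>W. 2 * w (fst p))"
    proof (rule sum_mono)
      fix p assume "p \<in> W"
      then have "p \<in> \<Gamma>" using W by (auto simp: collections_def)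
      then show "card (snd p) \<le> 2 * w (fst p)" by (rule card_polymer_le)
    qed
    also have "\<dots> = 2 * k"
      using W by (simp add: collections_def flip: sum_distrib_left)
    finally show False using A by simp
  qed
  then have "{W \<in> coll A k. (\<Union>p\<in>W. snd p) = A} = {}" by blast
  then show "real (card {W \<in> coll A k. (\<Union>p\<in>W. snd p) = A}) = 0" by (simp only: card.empty of_nat_0)
qed

text \<open>The \<open>k\<close>-th coefficient of \<open>Z' / Z\<close> comes from the coefficients of \<open>Z\<close> up to index \<open>k + 1\<close>, by products whose
  indices add up to \<open>k + 1\<close>.\<close>

lemma interaction_le_log_deriv: "interaction_le (2 * Suc k) (\<lambda>B. log_deriv (Z B) $ k)"
proof (induction k rule: less_induct)
  case (less k)
  have "interaction_le (2 * Suc k) (\<lambda>B. log_deriv (Z B) $ j * Z B $ (k - j))" if "j < k" for j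
    using that
    by (intro interaction_le_mono[OF interaction_le_mult[OF less interaction_le_partition]]) auto
  moreover have "(\<lambda>B. log_deriv (Z B) $ k) = (\<lambda>B. real (Suc k) * Z B $ Suc k
      + (-1) * (\<Sum>j<k. log_deriv (Z B) $ j * Z B $ (k - j)))"
    by (rule ext) (rule log_deriv_nth[OF partition_fps_0])
  ultimately show ?case
    by (simp only:) (intro interaction_le_add interaction_le_scale interaction_le_sum
      interaction_le_partition, auto)
qed

lemma sum_cluster_weight:
  "finite A \<Longrightarrow> (\<Sum>B\<in>Pow A. \<phi> k B) = log_deriv (Z A) $ k"
  unfolding cluster_weight_def by (rule sum_mobius)

lemma cluster_weight_empty: "\<phi> k {} = 0"
  using sum_cluster_weight[of "{}" k] by (simp add: partition_fps_empty log_deriv_def)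

lemma cluster_weight_eq_0_if_separated:
  assumes A: "finite A" "A1 \<inter> A2 = {}" "A1 \<union> A2 = A" "A1 \<noteq> {}" "A2 \<noteq> {}"
    and sep: "\<And>p. p \<in> \<Gamma> \<Longrightarrow> w (fst p) \<le> Suc k \<Longrightarrow> snd p \<subseteq> A \<Longrightarrow> snd p \<subseteq> A1 \<or> snd p \<subseteq> A2"
  shows "\<phi> k A = 0"
  unfolding cluster_weight_def
proof (rule mobius_eq_0_if_additive[OF A])
  fix B assume B: "B \<subseteq> A"
  have "log_deriv (Z (B \<inter> A1 \<union> B \<inter> A2)) $ k = log_deriv (Z (B \<inter> A1)) $ k + log_deriv (Z (B \<inter> A2)) $ k"
  proof (rule log_deriv_partition_disjoint_union)
    show "finite (B \<inter> A1)" "finite (B \<inter> A2)" using A B by (auto intro: finite_subset)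
    show "B \<inter> A1 \<inter> (B \<inter> A2) = {}" using A by blast
    fix p assume "p \<in> \<Gamma>" "w (fst p) \<le> Suc k" "snd p \<subseteq> B \<inter> A1 \<union> B \<inter> A2"
    with sep[of p] B show "snd p \<subseteq> B \<inter> A1 \<or> snd p \<subseteq> B \<inter> A2" by blast
  qed
  moreover have "B \<inter> A1 \<union> B \<inter> A2 = B" using B A by blast
  ultimately show "log_deriv (Z B) $ k = log_deriv (Z (B \<inter> A1)) $ k + log_deriv (Z (B \<inter> A2)) $ k"
    by simp
qed

end

text \<open>If each of the \<open>m\<close> shells \<open>Q (Suc j) - Q j\<close> met \<open>A\<close>, then \<open>A\<close> would have at least \<open>m\<close> elements besides the one
  in \<open>Q 0\<close>.\<close>

lemma exists_empty_shell:
  fixes Q :: "nat \<Rightarrow> 'v set"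
  assumes "finite A" "card A \<le> m" "A \<inter> Q 0 \<noteq> {}" "mono Q"
  shows "\<exists>j<m. A \<inter> Q (Suc j) = A \<inter> Q j"
proof (rule ccontr)
  assume neg: "\<not> ?thesis"
  have "j < card (A \<inter> Q j)" if "j \<le> m" for j
    using that
  proof (induction j)
    case 0
    then show ?case using assms by (simp add: card_gt_0_iff)
  next
    case (Suc j)
    have "A \<inter> Q j \<subseteq> A \<inter> Q (Suc j)" using monoD[OF \<open>mono Q\<close>, of j "Suc j"] by auto
    moreover have "A \<inter> Q (Suc j) \<noteq> A \<inter> Q j" using neg Suc.prems by auto
    ultimately have "card (A \<inter> Q j) < card (A \<inter> Q (Suc j))"
      using assms(1) by (intro psubset_card_mono) auto
    then show ?case using Suc by simp
  qed
  from this[of m] have "m < card A"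
    using card_mono[of A "A \<inter> Q m"] assms(1) by simp
  then show False using assms(2) by simp
qed

text \<open>The sets \<open>Q j\<close> play the role of growing balls whose radius increases by the largest diameter of a
  polymer. A small set reaching beyond the last ball misses a shell, and no polymer jumps over a
  shell, so the set is separated. A large set has weight \<open>0\<close> by the degree bound.\<close>

lemma (in polymer_system) cluster_weight_eq_0_if_far:
  assumes A: "finite A" "A \<inter> Q 0 \<noteq> {}" "\<not> A \<subseteq> Q (2 * Suc k)" and "mono Q"
    and Q: "\<And>p j. p \<in> \<Gamma> \<Longrightarrow> w (fst p) \<le> Suc k \<Longrightarrow> snd p \<inter> Q j \<noteq> {} \<Longrightarrow> snd p \<subseteq> Q (Suc j)"
  shows "\<phi> k A = 0"
proof (cases "card A \<le> 2 * Suc k")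
  case False
  then show ?thesis
    using interaction_le_log_deriv[of k] A(1) by (auto simp: interaction_le_def cluster_weight_def)
next
  case True
  then obtain j where j: "j < 2 * Suc k" "A \<inter> Q (Suc j) = A \<inter> Q j"
    using exists_empty_shell[of A _ Q] A \<open>mono Q\<close> by blast
  show ?thesis
  proof (rule cluster_weight_eq_0_if_separated[of A "A \<inter> Q j" "A - Q j"])
    show "A \<inter> Q j \<noteq> {}" using A(2) monoD[OF \<open>mono Q\<close>, of 0 j] by auto
    show "A - Q j \<noteq> {}" using A(3) monoD[OF \<open>mono Q\<close>, of j "2 * Suc k"] j(1) by auto
    fix p assume p: "p \<in> \<Gamma>" "w (fst p) \<le> Suc k" "snd p \<subseteq> A"
    show "snd p \<subseteq> A \<inter> Q j \<or> snd p \<subseteq> A - Q j"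
      using Q[OF p(1,2), of j] p(3) j(2) by blast
  qed (use A in auto)
qed

text \<open>The weight of \<open>A\<close> depends only on the partition functions of its subsets, up to index \<open>k + 1\<close>.\<close>

lemma cluster_weight_transport:
  assumes "polymer_system \<Gamma> w" and inj: "inj_on g A"
    and \<Gamma>': "\<And>B. B \<subseteq> A \<Longrightarrow> {p \<in> \<Gamma>'. snd p \<subseteq> g ` B \<and> w (fst p) \<le> Suc k}
          = apsnd ((`) g) ` {p \<in> \<Gamma>. snd p \<subseteq> B \<and> w (fst p) \<le> Suc k}"
  shows "cluster_weight \<Gamma>' w k (g ` A) = cluster_weight \<Gamma> w k A"
proof -
  interpret polymer_system \<Gamma> w by fact
  have ld: "log_deriv (partition_fps \<Gamma>' w (g ` B)) $ k = log_deriv (Z B) $ k" if B: "B \<subseteq> A" for B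
  proof -
    have "Z B $ i = partition_fps \<Gamma>' w (g ` B) $ i" if i: "i \<le> Suc k" for i
    proof -
      have "{p \<in> \<Gamma>'. snd p \<subseteq> g ` B \<and> w (fst p) \<le> i}
          = {p \<in> \<Gamma>'. snd p \<subseteq> g ` B \<and> w (fst p) \<le> Suc k} \<inter> {p. w (fst p) \<le> i}"
        using i by auto
      also have "\<dots> = apsnd ((`) g) ` {p \<in> \<Gamma>. snd p \<subseteq> B \<and> w (fst p) \<le> i}"
        unfolding \<Gamma>'[OF B] using i by force
      finally show ?thesis
        using card_collections_transport[OF inj_on_subset[OF inj B], of \<Gamma>' w i \<Gamma>]
        by (simp add: partition_fps_def)
    qed
    then show ?thesis using log_deriv_cong[of "Z B" k] by simp
  qed
  have inj': "inj_on ((`) g) (Pow A)" by (rule inj_on_image_Pow[OF inj])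
  have "cluster_weight \<Gamma>' w k (g ` A)
      = (\<Sum>B\<in>(`) g ` Pow A. (-1) ^ (card (g ` A) + card B) * log_deriv (partition_fps \<Gamma>' w B) $ k)"
    unfolding cluster_weight_def mobius_def by (simp only: image_Pow_surj)
  also have "\<dots> = (\<Sum>B\<in>Pow A. (-1) ^ (card (g ` A) + card (g ` B)) *
      log_deriv (partition_fps \<Gamma>' w (g ` B)) $ k)"
    by (simp add: sum.reindex[OF inj'])
  also have "\<dots> = cluster_weight \<Gamma> w k A"
    unfolding cluster_weight_def mobius_def using ld
    by (intro sum.cong refl) (auto simp: card_image[OF inj] card_image[OF inj_on_subset[OF inj]])
  finally show ?thesis .
qed

text \<open>Each set shares its weight equally among its elements; by transitivity all elements of \<open>T\<close> receive
  as much as \<open>z\<close>.\<close>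

lemma (in polymer_system) log_deriv_partition_transitive:
  assumes T: "finite T"
    and \<tau>: "\<And>v. v \<in> T \<Longrightarrow> bij_betw (\<tau> v) T T" "\<And>v. v \<in> T \<Longrightarrow> \<tau> v z = v" and z: "z \<in> T"
    and inv: "\<And>v A. v \<in> T \<Longrightarrow> A \<subseteq> T \<Longrightarrow> \<phi> k (\<tau> v ` A) = \<phi> k A"
  shows "log_deriv (Z T) $ k = real (card T) * (\<Sum>A | A \<subseteq> T \<and> z \<in> A. \<phi> k A / real (card A))"
proof -
  have "log_deriv (Z T) $ k = (\<Sum>A\<in>Pow T. \<phi> k A)" using T by (simp add: sum_cluster_weight)
  also have "\<dots> = (\<Sum>A\<in>Pow T. \<Sum>v | v \<in> T \<and> v \<in> A. \<phi> k A / real (card A))"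
  proof (rule sum.cong[OF refl])
    fix A assume "A \<in> Pow T"
    then have "{v. v \<in> T \<and> v \<in> A} = A" "finite A" using T by (auto intro: finite_subset)
    then show "\<phi> k A = (\<Sum>v | v \<in> T \<and> v \<in> A. \<phi> k A / real (card A))"
      by (cases "A = {}") (simp_all add: cluster_weight_empty)
  qed
  also have "\<dots> = (\<Sum>v\<in>T. \<Sum>A | A \<in> Pow T \<and> v \<in> A. \<phi> k A / real (card A))"
    using T by (intro sum.swap_restrict) auto
  also have "\<dots> = (\<Sum>v\<in>T. \<Sum>A | A \<subseteq> T \<and> z \<in> A. \<phi> k A / real (card A))"
  proof (rule sum.cong[OF refl])
    fix v assume v: "v \<in> T"
    have inj: "inj_on (\<tau> v) T" and img: "\<tau> v ` T = T"
      using \<tau>(1)[OF v] by (auto simp: bij_betw_def)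
    have inj': "inj_on ((`) (\<tau> v)) {A. A \<subseteq> T \<and> z \<in> A}"
      by (rule inj_on_subset[OF inj_on_image_Pow[OF inj]]) auto
    have "{A \<in> Pow T. v \<in> A} = (`) (\<tau> v) ` {A. A \<subseteq> T \<and> z \<in> A}"
    proof (intro equalityI subsetI)
      fix A assume A: "A \<in> {A \<in> Pow T. v \<in> A}"
      then obtain B where B: "B \<subseteq> T" "A = \<tau> v ` B" using img by (metis (no_types, lifting) Pow_iff mem_Collect_eq subset_imageE)
      then obtain b where "b \<in> B" "\<tau> v b = \<tau> v z" using A \<tau>(2)[OF v] by auto
      then have "z \<in> B" using inj_onD[OF inj] B z by (metis subsetD)
      with B show "A \<in> (`) (\<tau> v) ` {A. A \<subseteq> T \<and> z \<in> A}" by blast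
    next
      fix A assume "A \<in> (`) (\<tau> v) ` {A. A \<subseteq> T \<and> z \<in> A}"
      then obtain B where B: "B \<subseteq> T" "z \<in> B" "A = \<tau> v ` B" by blast
      then have "A \<subseteq> T" using img by blast
      moreover have "v \<in> A" using B(2,3) \<tau>(2)[OF v] by (metis imageI)
      ultimately show "A \<in> {A \<in> Pow T. v \<in> A}" by simp
    qed
    then have "(\<Sum>A | A \<in> Pow T \<and> v \<in> A. \<phi> k A / real (card A))
        = (\<Sum>A | A \<subseteq> T \<and> z \<in> A. \<phi> k (\<tau> v ` A) / real (card (\<tau> v ` A)))"
      by (simp add: sum.reindex[OF inj'])
    also have "\<dots> = (\<Sum>A | A \<subseteq> T \<and> z \<in> A. \<phi> k A / real (card A))"
      by (intro sum.cong refl) (auto simp: inv[OF v] card_image[OF inj_on_subset[OF inj]])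
    finally show "(\<Sum>A | A \<in> Pow T \<and> v \<in> A. \<phi> k A / real (card A))
        = (\<Sum>A | A \<subseteq> T \<and> z \<in> A. \<phi> k A / real (card A))" .
  qed
  finally show ?thesis by simp
qed

unbundle no fps_syntax
unbundle vec_syntax

section \<open>Geometry of figures\<close>

lemma figure_eq_translates:
  assumes "F \<in> figures" "X \<in> F"
  shows "F = translation_rel `` {X}" and "finite X" and "F = {(+) t ` X | t. True}"
proof -
  from assms(1) obtain A where A: "finite A" "F = translation_rel `` {A}"
    unfolding figures_def by (auto elim: quotientE)
  then have "(A, X) \<in> translation_rel" using assms(2) by simp
  then show F: "F = translation_rel `` {X}" and X: "finite X"
    unfolding A(2) using equiv_class_eq[OF equiv_translation_rel] by (blast, simp add: translation_rel_def)
  show "F = {(+) t ` X | t. True}"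
    using X unfolding F by (auto simp: translation_rel_def)
qed

lemma translate_in_figure: "F \<in> figures \<Longrightarrow> X \<in> F \<Longrightarrow> (+) t ` X \<in> F"
  using figure_eq_translates(3)[of F X] by blast

lemma grid_adj_coordinate_le: "grid_adj u v \<Longrightarrow> \<bar>u $ i - v $ i\<bar> \<le> 1"
  by (auto simp: grid_adj_def axis_def)

lemma not_grid_adj_self: "\<not> grid_adj u u"
  by (auto simp: grid_adj_def axis_eq_0_iff)

text \<open>A connected set with an edge has no isolated vertices, so its edges cover it.\<close>

lemma card_le_twice_card_edges:
  assumes "finite A" "induced_connected A" "induced_edges A \<noteq> {}"
  shows "card A \<le> 2 * card (induced_edges A)"
proof -
  let ?R = "{(x, y). x \<in> A \<and> y \<in> A \<and> grid_adj x y}"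
  obtain a b where ab: "a \<in> A" "b \<in> A" "grid_adj a b"
    using assms(3) by (auto simp: induced_edges_def)
  then have "a \<noteq> b" using not_grid_adj_self by auto
  have "A \<subseteq> \<Union>(induced_edges A)"
  proof
    fix u assume u: "u \<in> A"
    obtain v where v: "v \<in> A" "u \<noteq> v" using ab \<open>a \<noteq> b\<close> by metis
    then have "(u, v) \<in> ?R\<^sup>*" using assms(2) u by (auto simp: induced_connected_def)
    then obtain y where "y \<in> A" "grid_adj u y" using v(2) by (cases rule: converse_rtranclE) auto
    then show "u \<in> \<Union>(induced_edges A)" using u by (auto simp: induced_edges_def)
  qed
  moreover have sub: "induced_edges A \<subseteq> Pow A" by (auto simp: induced_edges_def)
  then have fin: "finite (induced_edges A)" using assms(1) by (auto intro: finite_subset)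
  moreover have "finite (\<Union>(induced_edges A))" using sub assms(1) by (auto intro: finite_subset)
  ultimately have "card A \<le> card (\<Union>(induced_edges A))" by (intro card_mono)
  also have "\<dots> \<le> (\<Sum>e\<in>induced_edges A. card e)" by (rule card_Union_le_sum_card)
  also have "\<dots> \<le> (\<Sum>e\<in>induced_edges A. 2)"
    by (intro sum_mono) (auto simp: induced_edges_def card_insert_if)
  finally show ?thesis by (simp add: mult.commute)
qed

text \<open>A path changes a coordinate by at most one per step, so the values of the coordinate on \<open>A\<close> fill
  the whole interval between any two of them.\<close>

lemma coordinate_spread_less_card:
  assumes "finite A" "induced_connected A" "u \<in> A" "v \<in> A"
  shows "\<bar>u $ i - v $ i\<bar> < int (card A)"
proof -
  have *: "v $ i - u $ i < int (card A)" if "u \<in> A" "v \<in> A" for u v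
  proof -
    have "(u, v) \<in> {(x, y). x \<in> A \<and> y \<in> A \<and> grid_adj x y}\<^sup>*"
      using assms(2) that by (simp add: induced_connected_def)
    then have "{u $ i..v $ i} \<subseteq> (\<lambda>x. x $ i) ` A"
    proof (induction rule: rtrancl_induct)
      case base
      then show ?case using that by auto
    next
      case (step y z)
      then have "\<bar>y $ i - z $ i\<bar> \<le> 1" using grid_adj_coordinate_le by blast
      then have "{u $ i..z $ i} \<subseteq> {u $ i..y $ i} \<union> {z $ i}" by auto
      then show ?case using step by blast
    qed
    then have "card {u $ i..v $ i} \<le> card A"
      using assms(1) by (meson card_image_le card_mono finite_imageI le_trans)
    then show ?thesis by simp
  qed
  show ?thesis using *[of u v] *[of v u] assms(3,4) by linarith
qed

section \<open>The torus\<close>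

definition torus :: "nat \<Rightarrow> (int ^ 'd) set" where
  "torus n = {v. \<forall>i. v $ i \<in> {0..<int n}}"

definition box :: "nat \<Rightarrow> (int ^ 'd) set" where
  "box r = {v. \<forall>i. v $ i \<in> {- int r..int r}}"

lemma card_vec_coordinates_in:
  "finite I \<Longrightarrow> finite {v :: 'a ^ 'd::finite. \<forall>i. v $ i \<in> I}"
  "finite I \<Longrightarrow> card {v :: 'a ^ 'd::finite. \<forall>i. v $ i \<in> I} = card I ^ CARD('d)"
proof -
  have eq: "{v :: 'a ^ 'd. \<forall>i. v $ i \<in> I} = vec_lambda ` (UNIV \<rightarrow>\<^sub>E I)"
  proof (intro equalityI subsetI)
    fix v :: "'a ^ 'd" assume "v \<in> {v. \<forall>i. v $ i \<in> I}"
    then show "v \<in> vec_lambda ` (UNIV \<rightarrow>\<^sub>E I)"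
      by (intro image_eqI[of _ _ "vec_nth v"]) auto
  qed auto
  have inj: "inj_on vec_lambda (UNIV \<rightarrow>\<^sub>E I :: ('d \<Rightarrow> 'a) set)"
    by (auto intro!: inj_onI simp: vec_lambda_inject)
  assume "finite I"
  then show "finite {v :: 'a ^ 'd. \<forall>i. v $ i \<in> I}"
    unfolding eq by (intro finite_imageI finite_PiE) auto
  show "card {v :: 'a ^ 'd. \<forall>i. v $ i \<in> I} = card I ^ CARD('d)"
    unfolding eq by (simp add: card_image[OF inj] card_PiE)
qed

lemma finite_torus: "finite (torus n :: (int ^ 'd::finite) set)"
  unfolding torus_def by (rule card_vec_coordinates_in) simp

lemma card_torus: "card (torus n :: (int ^ 'd::finite) set) = n ^ CARD('d)"
  unfolding torus_def by (subst card_vec_coordinates_in) auto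

lemma finite_box: "finite (box r :: (int ^ 'd::finite) set)"
  unfolding box_def by (rule card_vec_coordinates_in) simp

lemma torus_proj_nth [simp]: "torus_proj n v $ i = v $ i mod int n"
  by (simp add: torus_proj_def)

lemma torus_proj_in_torus: "n > 0 \<Longrightarrow> torus_proj n v \<in> torus n"
  by (simp add: torus_def)

lemma torus_proj_of_torus: "v \<in> torus n \<Longrightarrow> torus_proj n v = v"
  by (simp add: torus_def vec_eq_iff)

lemma torus_proj_eq_imp_eq:
  assumes "torus_proj n u = torus_proj n v" "\<And>i. \<bar>u $ i - v $ i\<bar> < int n"
  shows "u = v"
proof -
  have "u $ i = v $ i" for i
  proof -
    have "u $ i mod int n = v $ i mod int n" using assms(1) by (metis torus_proj_nth)
    then have "int n dvd u $ i - v $ i" by (simp add: mod_eq_dvd_iff)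
    with assms(2)[of i] show ?thesis using zdvd_not_zless[of "\<bar>u $ i - v $ i\<bar>" "int n"] by fastforce
  qed
  then show ?thesis by (simp add: vec_eq_iff)
qed

definition torus_shift :: "nat \<Rightarrow> int ^ 'd \<Rightarrow> int ^ 'd \<Rightarrow> int ^ 'd" where
  "torus_shift n t v = torus_proj n (v + t)"

lemma torus_shift_proj: "torus_shift n t (torus_proj n v) = torus_proj n (t + v)"
  by (simp add: torus_shift_def vec_eq_iff mod_simps add.commute)

lemma torus_shift_inverse: "v \<in> torus n \<Longrightarrow> torus_shift n t (torus_shift n (- t) v) = v"
  by (simp add: torus_shift_def vec_eq_iff mod_simps torus_def)

lemma bij_betw_torus_shift: "n > 0 \<Longrightarrow> bij_betw (torus_shift n t) (torus n) (torus n)"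
  using torus_shift_inverse[of _ n t] torus_shift_inverse[of _ n "- t"]
  by (intro bij_betw_byWitness[where f' = "torus_shift n (- t)"])
    (auto simp: torus_shift_def torus_proj_in_torus)

section \<open>Figures as polymers\<close>

definition lattice_polymers :: "('d::finite) figure set \<Rightarrow> ('d figure \<times> (int ^ 'd) set) set" where
  "lattice_polymers S = {(F, X). F \<in> S \<and> X \<in> F}"

definition torus_polymers :: "('d::finite) figure set \<Rightarrow> nat \<Rightarrow> ('d figure \<times> (int ^ 'd) set) set" where
  "torus_polymers S n = {(F, X). F \<in> S \<and> X \<in> placements n F}"

lemma placement_subset_torus: "n > 0 \<Longrightarrow> X \<in> placements n F \<Longrightarrow> X \<subseteq> torus n"
  by (auto simp: placements_def torus_proj_in_torus)

lemma placed_collections_eq: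
  assumes "n > 0"
  shows "placed_collections S k n = collections (torus_polymers S n) figure_edges (torus n) k"
proof -
  have "(\<forall>(F, X)\<in>W. F \<in> S \<and> X \<in> placements n F)
      \<longleftrightarrow> W \<subseteq> torus_polymers S n \<and> (\<forall>p\<in>W. snd p \<subseteq> torus n)" for W
    using placement_subset_torus[OF assms] by (fastforce simp: torus_polymers_def)
  then show ?thesis
    unfolding placed_collections_def collections_def by (simp add: case_prod_unfold)
qed

text \<open>Clusters of index \<open>k\<close> have at most \<open>2(k + 1)\<close> vertices, and they consist of figures with at most \<open>k + 1\<close>
  edges, whose vertices differ by at most \<open>2(k + 1)\<close> in each coordinate.\<close>

definition cluster_radius :: "nat \<Rightarrow> nat" where
  "cluster_radius k = 2 * Suc k * (2 * Suc k)"

lemma cluster_radius_mono: "j \<le> k \<Longrightarrow> cluster_radius j \<le> cluster_radius k"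
  unfolding cluster_radius_def by (intro mult_le_mono) auto

locale figure_family =
  fixes S :: "('d::finite) figure set"
  assumes S_figures: "S \<subseteq> figures"
    and S_connected: "\<forall>F\<in>S. connected_figure F"
    and S_edges: "\<forall>F\<in>S. figure_edges F > 0"
begin

lemma figureD:
  assumes "F \<in> S" "X \<in> F"
  shows "finite X" "X \<noteq> {}" "card X \<le> 2 * figure_edges F"
    and "u \<in> X \<Longrightarrow> v \<in> X \<Longrightarrow> \<bar>u $ i - v $ i\<bar> \<le> 2 * int (figure_edges F)"
proof -
  have F: "F \<in> figures" using assms S_figures by blast
  show fin: "finite X" by (rule figure_eq_translates[OF F assms(2)])
  have conn: "induced_connected X"
    using S_connected assms by (auto simp: connected_figure_def)
  then show "X \<noteq> {}" by (simp add: induced_connected_def)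
  have edges: "figure_edges F = card (induced_edges X)" by (rule figure_edges_eq[OF F assms(2)])
  moreover have "figure_edges F > 0" using S_edges assms by blast
  ultimately show card: "card X \<le> 2 * figure_edges F"
    using card_le_twice_card_edges[OF fin conn] by fastforce
  show "\<bar>u $ i - v $ i\<bar> \<le> 2 * int (figure_edges F)" if "u \<in> X" "v \<in> X"
    using coordinate_spread_less_card[OF fin conn that, of i] card by linarith
qed

lemma translate_in_family: "F \<in> S \<Longrightarrow> X \<in> F \<Longrightarrow> (+) t ` X \<in> F"
  using S_figures translate_in_figure by blast

lemma polymer_system_lattice: "polymer_system (lattice_polymers S) figure_edges"
proof
  fix B :: "(int ^ 'd) set" assume B: "finite B"
  let ?P = "{p \<in> lattice_polymers S. snd p \<subseteq> B}"
  have "inj_on snd ?P"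
  proof (rule inj_onI)
    fix p q assume "p \<in> ?P" "q \<in> ?P" "snd p = snd q"
    then have "fst p \<in> figures" "fst q \<in> figures" "snd p \<in> fst p" "snd p \<in> fst q"
      using S_figures by (auto simp: lattice_polymers_def)
    then have "fst p = fst q" using figure_eq_translates(1) by metis
    with \<open>snd p = snd q\<close> show "p = q" by (simp add: prod_eq_iff)
  qed
  moreover have "finite (snd ` ?P)"
    by (rule finite_subset[of _ "Pow B"]) (use B in auto)
  ultimately show "finite ?P" by (rule finite_imageD[rotated])
qed (use figureD in \<open>auto simp: lattice_polymers_def\<close>)

lemma polymer_system_torus: "polymer_system (torus_polymers S n) figure_edges"
proof
  fix B :: "(int ^ 'd) set" assume B: "finite B"
  let ?P = "{p \<in> torus_polymers S n. snd p \<subseteq> B}"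
  have "fst p \<in> (\<lambda>A. translation_rel `` {A}) ` Pow (box n)" if p: "p \<in> ?P" for p
  proof -
    obtain A where A: "fst p \<in> S" "A \<in> fst p" "\<forall>u\<in>A. \<forall>v\<in>A. \<forall>i. \<bar>u $ i - v $ i\<bar> < int n"
      using p by (auto simp: torus_polymers_def placements_def)
    \<comment> \<open>a figure with a placement has a representative in a fixed box, so there are finitely many\<close>
    obtain a where a: "a \<in> A" using figureD(2)[OF A(1,2)] by blast
    have "(+) (- a) ` A \<subseteq> box n"
    proof
      fix x assume "x \<in> (+) (- a) ` A"
      then obtain u where u: "u \<in> A" "x = - a + u" by blast
      then have "\<bar>x $ i\<bar> < int n" for i using A(3) a by simp
      then have "- int n \<le> x $ i \<and> x $ i \<le> int n" for i
        using \<open>\<And>i. \<bar>x $ i\<bar> < int n\<close>[of i] by linarith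
      then show "x \<in> box n" by (simp add: box_def)
    qed
    moreover have "(+) (- a) ` A \<in> fst p" using translate_in_family A by blast
    then have "fst p = translation_rel `` {(+) (- a) ` A}"
      using figure_eq_translates(1) A(1) S_figures by blast
    ultimately show ?thesis by blast
  qed
  then have "?P \<subseteq> (\<lambda>A. translation_rel `` {A}) ` Pow (box n) \<times> Pow B" by force
  then show "finite ?P"
    by (rule finite_subset) (intro finite_cartesian_product finite_imageI finite_Pow_iff[THEN iffD2] finite_box B)
next
  fix p assume "p \<in> torus_polymers S n"
  then obtain A where A: "fst p \<in> S" "A \<in> fst p" "snd p = torus_proj n ` A"
    by (auto simp: torus_polymers_def placements_def)
  then show "finite (snd p)" "snd p \<noteq> {}" "card (snd p) \<le> 2 * figure_edges (fst p)"
    using figureD[OF A(1,2)] card_image_le[of A "torus_proj n"] by auto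
qed

lemma torus_polymer_shift:
  assumes "(F, X) \<in> torus_polymers S n"
  shows "(F, torus_shift n t ` X) \<in> torus_polymers S n"
proof -
  obtain A where A: "F \<in> S" "A \<in> F" "X = torus_proj n ` A"
      "\<forall>u\<in>A. \<forall>v\<in>A. \<forall>i. \<bar>u $ i - v $ i\<bar> < int n"
    using assms by (auto simp: torus_polymers_def placements_def)
  have "torus_shift n t ` X = torus_proj n ` (+) t ` A"
    unfolding A(3) image_image torus_shift_proj ..
  moreover have "\<forall>u\<in>(+) t ` A. \<forall>v\<in>(+) t ` A. \<forall>i. \<bar>u $ i - v $ i\<bar> < int n"
    using A(4) by simp
  ultimately show ?thesis
    using A(1) translate_in_family[OF A(1,2), of t]
    unfolding torus_polymers_def placements_def by blast
qed

text \<open>The shift by \<open>t\<close> is a bijection of the torus that preserves placements, with inverse the shift by \<open>-t\<close>.\<close>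

lemma cluster_weight_torus_shift:
  assumes n: "n > 0" and A: "A \<subseteq> torus n"
  shows "cluster_weight (torus_polymers S n) figure_edges k (torus_shift n t ` A)
       = cluster_weight (torus_polymers S n) figure_edges k A"
proof (rule cluster_weight_transport[OF polymer_system_torus])
  let ?\<Gamma> = "torus_polymers S n"
  show "inj_on (torus_shift n t) A"
    using bij_betw_torus_shift[OF n] A by (auto simp: bij_betw_def intro: inj_on_subset)
  fix B assume B: "B \<subseteq> A"
  have "p \<in> apsnd ((`) (torus_shift n t)) ` {p \<in> ?\<Gamma>. snd p \<subseteq> B \<and> figure_edges (fst p) \<le> Suc k}"
    if p: "p \<in> ?\<Gamma>" "snd p \<subseteq> torus_shift n t ` B" "figure_edges (fst p) \<le> Suc k" for p
  proof -
    let ?X = "torus_shift n (- t) ` snd p"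
    have "torus_shift n (- t) (torus_shift n t b) = b" if "b \<in> B" for b
      using torus_shift_inverse[of b n "- t"] that A B by auto
    then have "?X \<subseteq> B" using p(2) by fastforce
    moreover have "torus_shift n t ` ?X = snd p"
    proof -
      have "snd p \<subseteq> torus n"
        using p(1) placement_subset_torus[OF n, of "snd p" "fst p"] by (auto simp: torus_polymers_def)
      then show ?thesis using torus_shift_inverse[of _ n t] by (force simp: image_image)
    qed
    moreover have "(fst p, ?X) \<in> ?\<Gamma>" using torus_polymer_shift p(1) by simp
    ultimately show ?thesis
      using p(3) by (intro image_eqI[of _ _ "(fst p, ?X)"]) (simp_all add: prod_eq_iff)
  qed
  moreover have "apsnd ((`) (torus_shift n t)) p \<in> ?\<Gamma>" if "p \<in> ?\<Gamma>" for p
    using torus_polymer_shift[of "fst p" "snd p" n t] that by (simp add: apsnd_def map_prod_def case_prod_unfold)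
  ultimately show "{p \<in> ?\<Gamma>. snd p \<subseteq> torus_shift n t ` B \<and> figure_edges (fst p) \<le> Suc k}
      = apsnd ((`) (torus_shift n t)) ` {p \<in> ?\<Gamma>. snd p \<subseteq> B \<and> figure_edges (fst p) \<le> Suc k}"
    by (intro equalityI subsetI) (auto intro!: imageI dest: subsetD)
qed

text \<open>On the box the projection is injective. A placement inside the image of \<open>B\<close> lifts to a representative
  of the figure that has one vertex in \<open>B\<close>. All its other vertices are congruent modulo \<open>n\<close> to elements of
  \<open>B\<close>, and since they are too close to \<open>B\<close> to differ from these by a nonzero multiple of \<open>n\<close>, they lie in \<open>B\<close>.\<close>

lemma cluster_weight_torus_proj:
  assumes n: "2 * R + 2 * Suc k < n" and A: "A \<subseteq> box R"
  shows "cluster_weight (torus_polymers S n) figure_edges k (torus_proj n ` A)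
       = cluster_weight (lattice_polymers S) figure_edges k A"
proof (rule cluster_weight_transport[OF polymer_system_lattice])
  have box: "\<bar>u $ i - v $ i\<bar> \<le> 2 * int R" if "u \<in> box R" "v \<in> box R" for u v :: "int ^ 'd" and i
  proof -
    have "u $ i \<in> {- int R..int R}" "v $ i \<in> {- int R..int R}" using that by (simp_all add: box_def)
    then show ?thesis by auto
  qed
  show "inj_on (torus_proj n) A"
  proof (rule inj_onI)
    fix u v assume uv: "u \<in> A" "v \<in> A" "torus_proj n u = torus_proj n v"
    then have "\<bar>u $ i - v $ i\<bar> < int n" for i using box[of u v i] A n by force
    with uv(3) show "u = v" by (rule torus_proj_eq_imp_eq)
  qed
  fix B assume B: "B \<subseteq> A"
  have "p \<in> apsnd ((`) (torus_proj n)) `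
      {p \<in> lattice_polymers S. snd p \<subseteq> B \<and> figure_edges (fst p) \<le> Suc k}"
    if p: "p \<in> torus_polymers S n" "snd p \<subseteq> torus_proj n ` B" "figure_edges (fst p) \<le> Suc k" for p
  proof -
    obtain A' where A': "fst p \<in> S" "A' \<in> fst p" "snd p = torus_proj n ` A'"
      using p(1) by (auto simp: torus_polymers_def placements_def)
    obtain a where a: "a \<in> A'" using figureD(2)[OF A'(1,2)] by blast
    then obtain b where b: "b \<in> B" "torus_proj n a = torus_proj n b" using p(2) A'(3) by blast
    \<comment> \<open>move the representative by the multiple \<open>b - a\<close> of \<open>n\<close> so that it meets \<open>B\<close>\<close>
    let ?X = "(+) (b - a) ` A'"
    have X: "?X \<in> fst p" by (rule translate_in_family[OF A'(1,2)])
    have "torus_proj n (b - a + x) = torus_proj n x" for x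
    proof -
      have "(b $ i - a $ i + x $ i) mod int n = x $ i mod int n" for i
      proof -
        have "a $ i mod int n = b $ i mod int n" using b(2) by (metis torus_proj_nth)
        then have "(b $ i - a $ i) mod int n = 0" by (simp add: mod_eq_dvd_iff[symmetric])
        then show ?thesis by (metis add_0 mod_add_left_eq)
      qed
      then show ?thesis by (simp add: vec_eq_iff)
    qed
    then have proj: "torus_proj n ` ?X = snd p" by (simp add: A'(3) image_image)
    have "x \<in> B" if x: "x \<in> ?X" for x
    proof -
      obtain b' where b': "b' \<in> B" "torus_proj n x = torus_proj n b'"
        using x proj p(2) by blast
      have "b \<in> ?X" using a by (intro image_eqI[of _ _ a]) simp_all
      have "\<bar>x $ i - b' $ i\<bar> < int n" for i
        using figureD(4)[OF A'(1) X x \<open>b \<in> ?X\<close>, of i] box[of b b' i] p(3) n b(1) b'(1) A B by fastforce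
      then have "x = b'" by (rule torus_proj_eq_imp_eq[OF b'(2)])
      then show ?thesis using b'(1) by simp
    qed
    then have "(fst p, ?X) \<in> {p \<in> lattice_polymers S. snd p \<subseteq> B \<and> figure_edges (fst p) \<le> Suc k}"
      using X A'(1) p(3) by (auto simp: lattice_polymers_def)
    moreover have "p = apsnd ((`) (torus_proj n)) (fst p, ?X)"
      using proj by (simp add: prod_eq_iff)
    ultimately show ?thesis by (rule rev_image_eqI)
  qed
  moreover have "apsnd ((`) (torus_proj n)) p \<in> torus_polymers S n"
    if "p \<in> lattice_polymers S" "snd p \<subseteq> B" for p
  proof -
    have "\<forall>u\<in>snd p. \<forall>v\<in>snd p. \<forall>i. \<bar>u $ i - v $ i\<bar> < int n"
    proof (intro ballI allI)
      fix u v i assume "u \<in> snd p" "v \<in> snd p"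
      then show "\<bar>u $ i - v $ i\<bar> < int n" using box[of u v i] that(2) A B n by force
    qed
    then show ?thesis using that(1)
      by (cases p) (auto simp: lattice_polymers_def torus_polymers_def placements_def)
  qed
  ultimately show "{p \<in> torus_polymers S n. snd p \<subseteq> torus_proj n ` B \<and> figure_edges (fst p) \<le> Suc k}
      = apsnd ((`) (torus_proj n)) ` {p \<in> lattice_polymers S. snd p \<subseteq> B \<and> figure_edges (fst p) \<le> Suc k}"
    by (intro equalityI subsetI) (auto intro!: imageI dest: subsetD)
qed

text \<open>The weight of a single vertex, computed on the infinite grid and hence independent of \<open>n\<close>.\<close>

definition free_energy :: "nat \<Rightarrow> real" where
  "free_energy k = (\<Sum>A | A \<subseteq> box (cluster_radius k) \<and> 0 \<in> A.
     cluster_weight (lattice_polymers S) figure_edges k A / real (card A))"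

text \<open>The growing balls are the projections of boxes around the origin. A figure placed on a
  torus vertex of one box has a representative through that box, so it stays within the next one.\<close>

lemma cluster_weight_torus_eq_0:
  assumes A: "A \<subseteq> torus n" "0 \<in> A" "\<not> A \<subseteq> torus_proj n ` box (cluster_radius k)"
  shows "cluster_weight (torus_polymers S n) figure_edges k A = 0"
proof -
  interpret polymer_system "torus_polymers S n" figure_edges by (rule polymer_system_torus)
  define Q :: "nat \<Rightarrow> (int ^ 'd) set" where "Q = (\<lambda>j. torus_proj n ` box (j * (2 * Suc k)))"
  show ?thesis
  proof (rule cluster_weight_eq_0_if_far)
    show "finite A" using A(1) finite_torus by (rule finite_subset)
    have "0 \<in> Q 0" unfolding Q_def by (intro image_eqI[of _ _ 0]) (simp_all add: vec_eq_iff box_def)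
    then show "A \<inter> Q 0 \<noteq> {}" using A(2) by blast
    show "\<not> A \<subseteq> Q (2 * Suc k)" using A(3) unfolding Q_def cluster_radius_def .
    have "box r \<subseteq> (box s :: (int ^ 'd) set)" if "r \<le> s" for r s
    proof
      fix x :: "int ^ 'd" assume x: "x \<in> box r"
      have "x $ i \<in> {- int s..int s}" for i
      proof -
        have "x $ i \<in> {- int r..int r}" using x by (simp add: box_def)
        then show ?thesis using that by auto
      qed
      then show "x \<in> box s" by (simp add: box_def)
    qed
    then show "mono Q" unfolding Q_def by (intro monoI image_mono) (meson mult_le_mono1)
    fix p j assume p: "p \<in> torus_polymers S n" "figure_edges (fst p) \<le> Suc k" "snd p \<inter> Q j \<noteq> {}"
    obtain A' where A': "fst p \<in> S" "A' \<in> fst p" "snd p = torus_proj n ` A'"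
      using p(1) by (auto simp: torus_polymers_def placements_def)
    then obtain a b where ab: "a \<in> A'" "b \<in> box (j * (2 * Suc k))" "torus_proj n a = torus_proj n b"
      using p(3) by (auto simp: Q_def)
    have "torus_proj n x \<in> Q (Suc j)" if x: "x \<in> A'" for x
    proof -
      have "x $ i + b $ i - a $ i \<in> {- int (Suc j * (2 * Suc k))..int (Suc j * (2 * Suc k))}" for i
      proof -
        define s r where "s = int (j * (2 * Suc k))" and "r = 2 * int (Suc k)"
        have "b $ i \<in> {- s..s}" using ab(2) by (simp add: box_def s_def)
        moreover have "\<bar>x $ i - a $ i\<bar> \<le> r"
          using figureD(4)[OF A'(1,2) x ab(1)] by (rule order_trans) (use p(2) in \<open>simp add: r_def\<close>)
        moreover have "int (Suc j * (2 * Suc k)) = s + r"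
          by (simp add: s_def r_def algebra_simps)
        ultimately show ?thesis unfolding atLeastAtMost_iff by linarith
      qed
      then have "x + b - a \<in> box (Suc j * (2 * Suc k))" by (simp add: box_def)
      moreover have "torus_proj n x = torus_proj n (x + b - a)"
      proof -
        have "x $ i mod int n = (x $ i + b $ i - a $ i) mod int n" for i
        proof -
          have "a $ i mod int n = b $ i mod int n" using ab(3) by (metis torus_proj_nth)
          then have "int n dvd b $ i - a $ i" by (metis mod_eq_dvd_iff)
          then have "int n dvd (x $ i + b $ i - a $ i) - x $ i" by (simp add: algebra_simps)
          then show ?thesis by (metis mod_eq_dvd_iff)
        qed
        then show ?thesis by (simp add: vec_eq_iff)
      qed
      ultimately show ?thesis unfolding Q_def by blast
    qed
    then show "snd p \<subseteq> Q (Suc j)" unfolding A'(3) by (rule image_subsetI)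
  qed
qed

lemma log_deriv_torus:
  assumes n: "2 * cluster_radius k + 2 * Suc k < n"
  shows "fps_nth (log_deriv (partition_fps (torus_polymers S n) figure_edges (torus n))) k
    = real (n ^ CARD('d)) * free_energy k"
proof -
  interpret polymer_system "torus_polymers S n" figure_edges by (rule polymer_system_torus)
  have n0: "n > 0" using n by simp
  let ?B = "box (cluster_radius k) :: (int ^ 'd) set"
  let ?\<phi> = "cluster_weight (torus_polymers S n) figure_edges k"
  have zero: "(0 :: int ^ 'd) \<in> torus n" using n0 by (simp add: torus_def)
  have inj: "inj_on (torus_proj n) ?B"
  proof (rule inj_onI)
    fix u v :: "int ^ 'd" assume uv: "u \<in> ?B" "v \<in> ?B" "torus_proj n u = torus_proj n v"
    have "\<bar>u $ i - v $ i\<bar> < int n" for i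
    proof -
      have "u $ i \<in> {- int (cluster_radius k)..int (cluster_radius k)}"
        "v $ i \<in> {- int (cluster_radius k)..int (cluster_radius k)}" using uv by (simp_all add: box_def)
      then show ?thesis using n by auto
    qed
    with uv(3) show "u = v" by (rule torus_proj_eq_imp_eq)
  qed
  have "fps_nth (log_deriv (partition_fps (torus_polymers S n) figure_edges (torus n))) k
      = real (card (torus n :: (int ^ 'd) set)) * (\<Sum>A | A \<subseteq> torus n \<and> 0 \<in> A. ?\<phi> A / real (card A))"
  proof (rule log_deriv_partition_transitive[where \<tau> = "torus_shift n"])
    show "torus_shift n v 0 = v" if "v \<in> torus n" for v
      using torus_proj_of_torus[OF that] by (simp add: torus_shift_def)
  qed (use n0 zero finite_torus bij_betw_torus_shift cluster_weight_torus_shift in auto)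
  also have "(\<Sum>A | A \<subseteq> torus n \<and> 0 \<in> A. ?\<phi> A / real (card A))
      = (\<Sum>A | A \<subseteq> torus_proj n ` ?B \<and> 0 \<in> A. ?\<phi> A / real (card A))"
  proof (rule sum.mono_neutral_right)
    show "finite {A. A \<subseteq> (torus n :: (int ^ 'd) set) \<and> 0 \<in> A}"
      by (rule finite_subset[of _ "Pow (torus n)"]) (auto simp: finite_torus)
    show "{A. A \<subseteq> torus_proj n ` ?B \<and> 0 \<in> A} \<subseteq> {A. A \<subseteq> torus n \<and> 0 \<in> A}"
      using torus_proj_in_torus[OF n0] by blast
    show "\<forall>A\<in>{A. A \<subseteq> torus n \<and> 0 \<in> A} - {A. A \<subseteq> torus_proj n ` ?B \<and> 0 \<in> A}.
        ?\<phi> A / real (card A) = 0"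
    proof
      fix A assume "A \<in> {A. A \<subseteq> torus n \<and> 0 \<in> A} - {A. A \<subseteq> torus_proj n ` ?B \<and> 0 \<in> A}"
      then have "?\<phi> A = 0" by (intro cluster_weight_torus_eq_0) auto
      then show "?\<phi> A / real (card A) = 0" by simp
    qed
  qed
  also have "{A. A \<subseteq> torus_proj n ` ?B \<and> 0 \<in> A} = (`) (torus_proj n) ` {A. A \<subseteq> ?B \<and> 0 \<in> A}"
  proof (intro equalityI subsetI)
    have p0: "torus_proj n (0 :: int ^ 'd) = 0" by (simp add: vec_eq_iff)
    have b0: "(0 :: int ^ 'd) \<in> ?B" by (simp add: box_def)
    {
      fix A assume A: "A \<in> {A. A \<subseteq> torus_proj n ` ?B \<and> 0 \<in> A}"
      then obtain C where C: "C \<subseteq> ?B" "A = torus_proj n ` C" by (auto elim: subset_imageE)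
      then obtain c where "c \<in> C" "torus_proj n c = torus_proj n 0" using A p0 by auto
      then have "0 \<in> C" using inj_onD[OF inj] C(1) b0 by blast
      then show "A \<in> (`) (torus_proj n) ` {A. A \<subseteq> ?B \<and> 0 \<in> A}" using C by blast
    next
      fix A assume "A \<in> (`) (torus_proj n) ` {A. A \<subseteq> ?B \<and> 0 \<in> A}"
      then obtain C where "C \<subseteq> ?B" "0 \<in> C" "A = torus_proj n ` C" by blast
      then show "A \<in> {A. A \<subseteq> torus_proj n ` ?B \<and> 0 \<in> A}" using p0 by force
    }
  qed
  also have "(\<Sum>A\<in>(`) (torus_proj n) ` {A. A \<subseteq> ?B \<and> 0 \<in> A}. ?\<phi> A / real (card A))
      = (\<Sum>A | A \<subseteq> ?B \<and> 0 \<in> A. ?\<phi> (torus_proj n ` A) / real (card (torus_proj n ` A)))"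
  proof -
    have "inj_on ((`) (torus_proj n)) {A. A \<subseteq> ?B \<and> 0 \<in> A}"
      by (rule inj_on_subset[OF inj_on_image_Pow[OF inj]]) auto
    then show ?thesis by (simp add: sum.reindex)
  qed
  also have "\<dots> = free_energy k"
    unfolding free_energy_def
  proof (intro sum.cong refl)
    fix A :: "(int ^ 'd) set" assume "A \<in> {A. A \<subseteq> ?B \<and> 0 \<in> A}"
    then have "A \<subseteq> ?B" by simp
    then show "?\<phi> (torus_proj n ` A) / real (card (torus_proj n ` A))
        = cluster_weight (lattice_polymers S) figure_edges k A / real (card A)"
      using cluster_weight_torus_proj[OF n] card_image[OF inj_on_subset[OF inj]] by simp
  qed
  finally show ?thesis by (simp only: card_torus)
qed

text \<open>Both series start with \<open>1\<close>, and their logarithmic derivatives agree at all indices below \<open>k\<close>.\<close>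

lemma num_placed_eq_poly:
  assumes n: "2 * cluster_radius k + 2 * Suc k < n"
  shows "real (num_placed S k n) = poly (binomial_seq free_energy k) (real (n ^ CARD('d)))"
proof -
  interpret polymer_system "torus_polymers S n" figure_edges by (rule polymer_system_torus)
  have n0: "n > 0" using n by simp
  let ?Z = "partition_fps (torus_polymers S n) figure_edges (torus n)"
  let ?F = "Abs_fps (\<lambda>k. poly (binomial_seq free_energy k) (real (n ^ CARD('d))))"
  have "fps_nth ?Z k = fps_nth ?F k"
  proof (rule log_deriv_eq_imp_nth_eq)
    fix j assume "j < k"
    then have "2 * cluster_radius j + 2 * Suc j \<le> 2 * cluster_radius k + 2 * Suc k"
      using cluster_radius_mono[of j k] by simp
    then have "2 * cluster_radius j + 2 * Suc j < n" using n by (rule le_less_trans)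
    then show "fps_nth (log_deriv ?Z) j = fps_nth (log_deriv ?F) j"
      by (subst log_deriv_torus) (simp_all add: log_deriv_binomial_seq)
  qed simp_all
  then show ?thesis
    by (simp add: num_placed_def placed_collections_eq[OF n0] partition_fps_def)
qed

end

theorem theorem4p7:
  fixes S :: "('d::finite) figure set"
  assumes "S \<subseteq> figures"
    and "\<forall>F\<in>S. connected_figure F"
    and "\<forall>F\<in>S. figure_edges F > 0"
  shows "\<exists>P :: nat \<Rightarrow> real poly.
           binomial_type P \<and>
           (\<forall>k. \<forall>\<^sub>F n in sequentially.
              real (num_placed S k n) = poly (P k) (real (n ^ CARD('d))))"
proof -
  interpret figure_family S using assms by unfold_locales
  show ?thesis
  proof (intro exI conjI allI)
    show "binomial_type (binomial_seq free_energy)" by (rule binomial_type_binomial_seq)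
    fix k
    show "\<forall>\<^sub>F n in sequentially.
        real (num_placed S k n) = poly (binomial_seq free_energy k) (real (n ^ CARD('d)))"
      using eventually_gt_at_top by (rule eventually_mono) (rule num_placed_eq_poly)
  qed
qed

end
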